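(* Let $n\geq2$ and $k\geq2$ be integers. Let $\gamma:\mathbf{T}^1\to\mathbf{R}^n$ be an immersed closed $H^2$-curve with a point of multiplicity $k$. Then $$\bar{B}[\gamma]\geq \varpi^*k^2.$$
   Context: $\mathbf{T}^1:=\mathbf{R}/\mathbf{Z}$; $H^2=W^{2,2}$ is the Sobolev class, and $H^2\hookrightarrow C^1$, so a curve is immersed if $\gamma'\neq0$ everywhere. For an immersed $H^2$-curve $\gamma$ in $\mathbf{R}^n$ let $\partial_s:=\frac{1}{|\gamma'|}\partial_x$ ($x$ the parameter), $ds=|\gamma'|dx$, $\kappa:=\partial_s^2\gamma$ (curvature vector), $L[\gamma]:=\int_\gamma ds$, $B[\gamma]:=\int_\gamma|\kappa|^2ds$, and $\bar{B}[\gamma]:=L[\gamma]B[\gamma]$ (normalized bending energy). A curve $\gamma$ has a point $p\in\mathbf{R}^n$ of multiplicity $k$ if $\gamma^{-1}(p)$ contains at least $k$ distinct points. For $m\in(0,1)$ let $K(m)=\int_0^{\pi/2}\frac{d\theta}{\sqrt{1-m\sin^2\theta}}$ and $E(m)=\int_0^{\pi/2}\sqrt{1-m\sin^2\theta}\,d\theta$. Let $m^*\in(0,1)$ be the unique parameter with $K(m^* )=2E(m^* )$, and let $\varpi^*:=32(2m^*-1)E(m^* )^2>0$. *)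

theory Defs
  imports "HOL-Analysis.Analysis"
begin

text \<open>
  Maps on the circle \<open>T = R/Z\<close> are represented by 1-periodic maps on the real line, points of
  \<open>T\<close> by their representatives in \<open>[0,1)\<close>, and integrals over \<open>T\<close> by integrals over \<open>[0,1]\<close>.
\<close>

definition periodic1 :: "(real \<Rightarrow> 'b) \<Rightarrow> bool" where
  "periodic1 f \<longleftrightarrow> (\<forall>x. f (x + 1) = f x)"

definition circle_L1 :: "(real \<Rightarrow> 'a::euclidean_space) \<Rightarrow> bool" where
  "circle_L1 f \<longleftrightarrow> periodic1 f \<and> f \<in> borel_measurable lborel \<and> set_integrable lborel {0..1} f"

definition circle_L2 :: "(real \<Rightarrow> 'a::euclidean_space) \<Rightarrow> bool" where
  "circle_L2 f \<longleftrightarrow> periodic1 f \<and> f \<in> borel_measurable lborel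
     \<and> set_integrable lborel {0..1} (\<lambda>x. (norm (f x))\<^sup>2)"

definition circle_test :: "(real \<Rightarrow> real) \<Rightarrow> bool" where
  "circle_test \<phi> \<longleftrightarrow> periodic1 \<phi> \<and> (\<forall>j x. ((deriv ^^ j) \<phi>) field_differentiable (at x))"

definition has_weak_deriv ::
    "(real \<Rightarrow> 'a::euclidean_space) \<Rightarrow> (real \<Rightarrow> 'a) \<Rightarrow> bool" (infix "has'_weak'_deriv" 50) where
  "f has_weak_deriv g \<longleftrightarrow> circle_L1 f \<and> circle_L1 g \<and>
     (\<forall>\<phi>. circle_test \<phi> \<longrightarrow>
        (LINT x:{0..1}|lborel. deriv \<phi> x *\<^sub>R f x) = - (LINT x:{0..1}|lborel. \<phi> x *\<^sub>R g x))"

text \<open>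
  The Sobolev class \<open>W\<^sup>2\<^sup>,\<^sup>2(T)\<close>. Its members are equivalence classes modulo null sets;
  a curve is the continuous representative (which is then automatically \<open>C\<^sup>1\<close>).
\<close>

definition sobolev22 :: "(real \<Rightarrow> 'a::euclidean_space) \<Rightarrow> bool" where
  "sobolev22 f \<longleftrightarrow> circle_L2 f \<and>
     (\<exists>g h. f has_weak_deriv g \<and> g has_weak_deriv h \<and> circle_L2 g \<and> circle_L2 h)"

definition closed_H2_curve :: "(real \<Rightarrow> 'a::euclidean_space) \<Rightarrow> bool" where
  "closed_H2_curve \<gamma> \<longleftrightarrow> sobolev22 \<gamma> \<and> continuous_on UNIV \<gamma>"

definition immersed :: "(real \<Rightarrow> 'a::euclidean_space) \<Rightarrow> bool" where
  "immersed \<gamma> \<longleftrightarrow> (\<forall>x. vector_derivative \<gamma> (at x) \<noteq> 0)"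

definition speed :: "(real \<Rightarrow> 'a::euclidean_space) \<Rightarrow> real \<Rightarrow> real" where
  "speed \<gamma> x = norm (vector_derivative \<gamma> (at x))"

text \<open>
  A weak derivative is determined only up to null sets, so \<open>weak_deriv\<close> picks one
  representative; the integrals below do not depend on the choice.
\<close>

definition weak_deriv :: "(real \<Rightarrow> 'a::euclidean_space) \<Rightarrow> real \<Rightarrow> 'a" where
  "weak_deriv f = (SOME g. f has_weak_deriv g)"

definition arc_deriv ::
    "(real \<Rightarrow> 'a::euclidean_space) \<Rightarrow> (real \<Rightarrow> 'a) \<Rightarrow> real \<Rightarrow> 'a" where
  "arc_deriv \<gamma> f = (\<lambda>x. (1 / speed \<gamma> x) *\<^sub>R weak_deriv f x)"

definition curvature :: "(real \<Rightarrow> 'a::euclidean_space) \<Rightarrow> real \<Rightarrow> 'a" where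
  "curvature \<gamma> = arc_deriv \<gamma> (arc_deriv \<gamma> \<gamma>)"

definition curve_length :: "(real \<Rightarrow> 'a::euclidean_space) \<Rightarrow> real" where
  "curve_length \<gamma> = (LINT x:{0..1}|lborel. speed \<gamma> x)"

definition bending_energy :: "(real \<Rightarrow> 'a::euclidean_space) \<Rightarrow> real" where
  "bending_energy \<gamma> = (LINT x:{0..1}|lborel. (norm (curvature \<gamma> x))\<^sup>2 * speed \<gamma> x)"

definition normalized_bending_energy :: "(real \<Rightarrow> 'a::euclidean_space) \<Rightarrow> real" where
  "normalized_bending_energy \<gamma> = curve_length \<gamma> * bending_energy \<gamma>"

definition has_point_of_multiplicity ::
    "(real \<Rightarrow> 'a::euclidean_space) \<Rightarrow> 'a \<Rightarrow> nat \<Rightarrow> bool" where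
  "has_point_of_multiplicity \<gamma> p k \<longleftrightarrow>
     (\<exists>S. S \<subseteq> {x \<in> {0..<1}. \<gamma> x = p} \<and> finite S \<and> card S = k)"

definition ellipticK :: "real \<Rightarrow> real" where
  "ellipticK m = (LINT t:{0..pi/2}|lborel. 1 / sqrt (1 - m * (sin t)\<^sup>2))"

definition ellipticE :: "real \<Rightarrow> real" where
  "ellipticE m = (LINT t:{0..pi/2}|lborel. sqrt (1 - m * (sin t)\<^sup>2))"

definition m_star :: real where
  "m_star = (THE m. 0 < m \<and> m < 1 \<and> ellipticK m = 2 * ellipticE m)"

definition varpi_star :: real where
  "varpi_star = 32 * (2 * m_star - 1) * (ellipticE m_star)\<^sup>2"

end

(*
  Let T be the unit tangent of a loop of length L, e the value of T at the arclength midpoint and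
  c = <T, e>.  In the variable c the bending density c'^2 / (1 - c^2) is jointly convex, and the loop
  condition integral c = 0 is linear.  Hence, on each half of the loop, comparison with the
  tangent lines of this convex integrand along the half figure-eight elastica (a pendulum with
  amplitude parameter m* ) gives the sharp bound B >= varpi*/L for a single loop.  The comparison
  pendulum runs slightly slower than the extremal one, which keeps it away from the
  singularity c = 1 of the integrand.  A point of multiplicity k splits the curve into k loops, and the
  Cauchy-Schwarz inequality yields the factor k^2.
*)
theory Submission
  imports Defs
begin

section \<open>Absolutely continuous functions and their densities\<close>

text \<open>The curvature is only square integrable, so the unit tangent has no derivative at a
  given point. All calculus with it passes through \<open>primitive_on F f\<close>, where F is
  recovered from a density f on every subinterval; chain and product rules are proved for this
  relation, and weak derivatives are turned into it by testing with trigonometric polynomials. The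
  bound for a half loop is a calibration. Convexity puts the bending density above an expression
  affine in c and c', with coefficients taken from the comparison pendulum. By the Euler-Lagrange
  equation its terms in c and c' form an exact derivative plus a constant multiple of c with respect
  to arclength. The boundary terms vanish because c = 1 at the midpoint of the loop and the
  coefficient q is 0 at its end; the multiple of c carries the Lagrange multiplier of the loop
  condition and cancels between the halves. Each m in (0,1) yields a bound in this way, and K = 2E
  is the condition under which the pendulum itself closes up.\<close>

definition primitive_on :: "(real \<Rightarrow> 'a::euclidean_space) \<Rightarrow> (real \<Rightarrow> 'a) \<Rightarrow> real \<Rightarrow> real \<Rightarrow> bool" where
  "primitive_on F f a b \<longleftrightarrow> f absolutely_integrable_on {a..b} \<and>
     (\<forall>x y. a \<le> x \<longrightarrow> x \<le> y \<longrightarrow> y \<le> b \<longrightarrow> (f has_integral (F y - F x)) {x..y})"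

lemma primitive_on_has_integral:
  "primitive_on F f a b \<Longrightarrow> a \<le> x \<Longrightarrow> x \<le> y \<Longrightarrow> y \<le> b \<Longrightarrow> (f has_integral (F y - F x)) {x..y}"
  by (simp add: primitive_on_def)

lemma primitive_on_absint: "primitive_on F f a b \<Longrightarrow> f absolutely_integrable_on {a..b}"
  by (simp add: primitive_on_def)

lemma primitive_on_subset:
  assumes "primitive_on F f a b" "a \<le> c" "d \<le> b"
  shows "primitive_on F f c d"
  using assms absolutely_integrable_on_subinterval[where f=f and S="{a..b}" and a=c and b=d]
  unfolding primitive_on_def by auto

lemma primitive_on_continuous:
  assumes "primitive_on F f a b" shows "continuous_on {a..b} F"
proof (cases "a \<le> b")
  case True
  have "f integrable_on {a..b}"
    using assms absolutely_integrable_on_def primitive_on_absint by blast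
  then have "continuous_on {a..b} (\<lambda>x. F a + integral {a..x} f)"
    by (intro continuous_intros indefinite_integral_continuous_1)
  moreover have "F a + integral {a..x} f = F x" if "x \<in> {a..b}" for x
    using primitive_on_has_integral[OF assms, of a x] that by (simp add: integral_unique)
  ultimately show ?thesis using continuous_on_cong[OF refl, of "{a..b}" "\<lambda>x. F a + integral {a..x} f" F] by blast
qed auto

lemma primitive_on_norm_le:
  assumes "primitive_on F f a b" "a \<le> x" "x \<le> y" "y \<le> b"
  shows "norm (F y - F x) \<le> integral {x..y} (\<lambda>z. norm (f z))"
proof -
  have "(f has_integral (F y - F x)) {x..y}" using primitive_on_has_integral assms by blast
  moreover have "f absolutely_integrable_on {x..y}"
    using primitive_on_subset[OF assms(1,2,4)] primitive_on_absint by blast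
  ultimately show ?thesis
    using integral_norm_bound_integral[of f "{x..y}" "\<lambda>z. norm (f z)"]
    by (auto simp: absolutely_integrable_on_def integral_unique)
qed

text \<open>Replaces differentiation almost everywhere. The defect of \<open>G\<close> and the bound
  \<open>e * integral m\<close> both add up over adjacent intervals, so an estimate near each point
  becomes one on \<open>{x..y}\<close> by bisection; then e tends to 0.\<close>

lemma primitive_on_local:
  assumes g: "g absolutely_integrable_on {a..b}" and m: "m integrable_on {a..b}"
    and loc: "\<And>e t. e > 0 \<Longrightarrow> a \<le> t \<Longrightarrow> t \<le> b \<Longrightarrow> \<exists>d>0. \<forall>x y. a \<le> x \<and> x \<le> t \<and> t \<le> y \<and> y \<le> b \<and> y - x < d \<longrightarrow>
      norm (G y - G x - integral {x..y} g) \<le> e * integral {x..y} m"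
  shows "primitive_on G g a b"
proof -
  have gi: "g integrable_on {x..y}" if "a \<le> x" "y \<le> b" for x y
    using absolutely_integrable_on_subinterval[OF g, where a=x and b=y] that
    by (auto simp: absolutely_integrable_on_def)
  have mi: "m integrable_on {x..y}" if "a \<le> x" "y \<le> b" for x y
    using integrable_subinterval_real[OF m] that by auto
  have est: "norm (G y - G x - integral {x..y} g) \<le> e * integral {x..y} m"
    if xy: "a \<le> x" "x \<le> y" "y \<le> b" and e: "e > 0" for x y e
  proof -
    define P where "P u v \<longleftrightarrow> (x \<le> u \<longrightarrow> v \<le> y \<longrightarrow> norm (G v - G u - integral {u..v} g) \<le> e * integral {u..v} m)" for u v
    have "P x y" using \<open>x \<le> y\<close>
    proof (induction rule: Bolzano)
      case (trans u v w)
      show ?case unfolding P_def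
      proof (intro impI)
        assume uw: "x \<le> u" "w \<le> y"
        have 1: "norm (G v - G u - integral {u..v} g) \<le> e * integral {u..v} m"
          and 2: "norm (G w - G v - integral {v..w} g) \<le> e * integral {v..w} m"
          using trans uw unfolding P_def by auto
        have 3: "integral {u..v} g + integral {v..w} g = integral {u..w} g"
          using Henstock_Kurzweil_Integration.integral_combine[of u v w g] trans gi[of u w] uw xy by auto
        have 4: "integral {u..v} m + integral {v..w} m = integral {u..w} m"
          using Henstock_Kurzweil_Integration.integral_combine[of u v w m] trans mi[of u w] uw xy by auto
        have eq: "G w - G u - integral {u..w} g = (G v - G u - integral {u..v} g) + (G w - G v - integral {v..w} g)"
          using 3[symmetric] by (simp add: algebra_simps)
        have "norm (G w - G u - integral {u..w} g) \<le> e * integral {u..v} m + e * integral {v..w} m"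
          unfolding eq by (rule order_trans[OF norm_triangle_ineq add_mono[OF 1 2]])
        then show "norm (G w - G u - integral {u..w} g) \<le> e * integral {u..w} m"
          using 4[symmetric] by (simp add: algebra_simps)
      qed
    next
      case (local t)
      then obtain d where "d > 0" "\<forall>x y. a \<le> x \<and> x \<le> t \<and> t \<le> y \<and> y \<le> b \<and> y - x < d \<longrightarrow>
          norm (G y - G x - integral {x..y} g) \<le> e * integral {x..y} m"
        using loc[OF e, of t] xy by auto
      then show ?case unfolding P_def using xy by (intro exI[of _ d]) auto
    qed
    then show ?thesis unfolding P_def by simp
  qed
  have "G y - G x = integral {x..y} g" if xy: "a \<le> x" "x \<le> y" "y \<le> b" for x y
  proof -
    have "((\<lambda>e. e * integral {x..y} m) \<longlongrightarrow> 0 * integral {x..y} m) (at_right 0)"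
      by (intro tendsto_intros)
    moreover have "eventually (\<lambda>e. norm (G y - G x - integral {x..y} g) \<le> e * integral {x..y} m) (at_right (0::real))"
      using est[OF xy] by (auto simp: eventually_at_right_less intro: eventually_mono[OF eventually_at_right_less[of 0]])
    ultimately have "norm (G y - G x - integral {x..y} g) \<le> 0 * integral {x..y} m"
      by (intro tendsto_lowerbound[where F="at_right (0::real)"]) auto
    then show ?thesis by simp
  qed
  then show ?thesis unfolding primitive_on_def using g gi
    by (metis integrable_integral)
qed

text \<open>In general \<open>F\<close> has no derivative at a given point. On a short interval
  around t, \<Phi> is expanded at \<open>F t\<close> and \<open>D\<close> is frozen at t; both
  errors are small multiples of the integral of \<open>norm (f t)\<close>, as
  \<open>primitive_on_local\<close> demands.\<close>

lemma primitive_on_compose: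
  fixes F :: "real \<Rightarrow> 'a::euclidean_space" and D :: "real \<Rightarrow> 'a \<Rightarrow>\<^sub>L 'b::euclidean_space"
  assumes F: "primitive_on F f a b"
    and der: "\<And>t. t \<in> {a..b} \<Longrightarrow> (\<Phi> has_derivative blinfun_apply (D t)) (at (F t))"
    and D: "continuous_on {a..b} D"
    and int: "(\<lambda>t. D t (f t)) absolutely_integrable_on {a..b}"
  shows "primitive_on (\<lambda>t. \<Phi> (F t)) (\<lambda>t. D t (f t)) a b"
proof (rule primitive_on_local[OF int])
  have fa: "f absolutely_integrable_on {a..b}" using F by (rule primitive_on_absint)
  show nf: "(\<lambda>t. norm (f t)) integrable_on {a..b}" using fa by (simp add: absolutely_integrable_on_def)
  fix e t :: real assume e: "e > 0" and t: "a \<le> t" "t \<le> b"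
  then have tin: "t \<in> {a..b}" by simp
  have e3: "e / 3 > 0" using e by simp
  from der[OF tin] obtain d1 where d1: "d1 > 0"
    "\<And>y. norm (y - F t) < d1 \<Longrightarrow> norm (\<Phi> y - \<Phi> (F t) - D t (y - F t)) \<le> e/3 * norm (y - F t)"
    unfolding has_derivative_at_alt using e3 by blast
  from primitive_on_continuous[OF F] tin d1(1) obtain d2 where d2: "d2 > 0"
    "\<And>s. s \<in> {a..b} \<Longrightarrow> dist s t < d2 \<Longrightarrow> dist (F s) (F t) < d1"
    unfolding continuous_on_iff by metis
  from D tin e3 obtain d3 where d3: "d3 > 0"
    "\<And>s. s \<in> {a..b} \<Longrightarrow> dist s t < d3 \<Longrightarrow> dist (D s) (D t) < e/3"
    unfolding continuous_on_iff by metis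
  show "\<exists>d>0. \<forall>x y. a \<le> x \<and> x \<le> t \<and> t \<le> y \<and> y \<le> b \<and> y - x < d \<longrightarrow>
      norm (\<Phi> (F y) - \<Phi> (F x) - integral {x..y} (\<lambda>t. D t (f t))) \<le> e * integral {x..y} (\<lambda>t. norm (f t))"
  proof (intro exI[of _ "min d2 d3"] conjI allI impI)
    show "min d2 d3 > 0" using d2 d3 by simp
    fix x y assume xy: "a \<le> x \<and> x \<le> t \<and> t \<le> y \<and> y \<le> b \<and> y - x < min d2 d3"
    let ?N = "\<lambda>u v. integral {u..v} (\<lambda>t. norm (f t))"
    have N: "?N x t + ?N t y = ?N x y"
      using Henstock_Kurzweil_Integration.integral_combine[of x t y "\<lambda>t. norm (f t)"] xy
        integrable_subinterval_real[OF nf, of x y] by auto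
    have ny: "norm (F y - F t) \<le> ?N t y" and nx: "norm (F t - F x) \<le> ?N x t"
      using primitive_on_norm_le[OF F, of t y] primitive_on_norm_le[OF F, of x t] xy t by auto
    have "dist (F y) (F t) < d1" "dist (F x) (F t) < d1"
      using d2(2)[of y] d2(2)[of x] xy t by (auto simp: dist_real_def)
    then have b1: "norm (\<Phi> (F y) - \<Phi> (F t) - D t (F y - F t)) \<le> e/3 * norm (F y - F t)"
      and b2: "norm (\<Phi> (F x) - \<Phi> (F t) - D t (F x - F t)) \<le> e/3 * norm (F x - F t)"
      using d1(2) by (auto simp: dist_norm)
    have fi: "(f has_integral (F y - F x)) {x..y}" using primitive_on_has_integral[OF F] xy by auto
    then have "((\<lambda>s. D t (f s)) has_integral (D t (F y - F x))) {x..y}"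
      using has_integral_linear[OF fi blinfun.bounded_linear_right[of "D t"]] by (simp add: o_def)
    moreover have Di: "(\<lambda>s. D s (f s)) integrable_on {x..y}"
      using absolutely_integrable_on_subinterval[OF int, where a=x and b=y] xy by (auto simp: absolutely_integrable_on_def)
    ultimately have di: "((\<lambda>s. D s (f s) - D t (f s)) has_integral (integral {x..y} (\<lambda>s. D s (f s)) - D t (F y - F x))) {x..y}"
      by (intro has_integral_diff) (auto simp: integrable_integral)
    have b3: "norm (integral {x..y} (\<lambda>s. D s (f s)) - D t (F y - F x)) \<le> integral {x..y} (\<lambda>s. e/3 * norm (f s))"
    proof -
      have "norm (integral {x..y} (\<lambda>s. D s (f s) - D t (f s))) \<le> integral {x..y} (\<lambda>s. e/3 * norm (f s))"
      proof (rule integral_norm_bound_integral)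
        show "(\<lambda>s. D s (f s) - D t (f s)) integrable_on {x..y}" using di by blast
        show "(\<lambda>s. e/3 * norm (f s)) integrable_on {x..y}"
          using integrable_subinterval_real[OF nf, of x y] xy integrable_on_cmult_left by fastforce
        fix s assume s: "s \<in> {x..y}"
        have "dist (D s) (D t) < e/3" using d3(2)[of s] s xy by (auto simp: dist_real_def)
        then have "norm (D s - D t) \<le> e/3" by (simp add: dist_norm)
        have "norm (D s (f s) - D t (f s)) = norm ((D s - D t) (f s))" by (simp add: blinfun.diff_left)
        also have "\<dots> \<le> norm (D s - D t) * norm (f s)" by (rule norm_blinfun)
        also have "\<dots> \<le> e/3 * norm (f s)" using \<open>norm (D s - D t) \<le> e/3\<close> by (intro mult_right_mono) auto
        finally show "norm (D s (f s) - D t (f s)) \<le> e/3 * norm (f s)" .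
      qed
      then show ?thesis using di by (simp add: integral_unique)
    qed
    have b3': "norm (integral {x..y} (\<lambda>s. D s (f s)) - D t (F y - F x)) \<le> e/3 * ?N x y"
      using b3 by simp
    have eq: "\<Phi> (F y) - \<Phi> (F x) - integral {x..y} (\<lambda>t. D t (f t)) =
       (\<Phi> (F y) - \<Phi> (F t) - D t (F y - F t)) - (\<Phi> (F x) - \<Phi> (F t) - D t (F x - F t))
        - (integral {x..y} (\<lambda>s. D s (f s)) - D t (F y - F x))"
      by (simp add: blinfun.diff_right algebra_simps)
    have "norm (\<Phi> (F y) - \<Phi> (F x) - integral {x..y} (\<lambda>t. D t (f t))) \<le>
       e/3 * norm (F y - F t) + e/3 * norm (F x - F t) + e/3 * ?N x y"
      unfolding eq using b1 b2 b3' by (smt (verit) norm_triangle_ineq4)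
    also have "\<dots> \<le> e/3 * ?N t y + e/3 * ?N x t + e/3 * ?N x y"
      using ny nx e by (intro add_mono mult_left_mono) (auto simp: norm_minus_commute)
    also have "\<dots> = e/3 * (?N x t + ?N t y) + e/3 * ?N x y" by (simp add: algebra_simps)
    also have "\<dots> \<le> e * ?N x y"
    proof -
      have "0 \<le> ?N x y" by (intro Henstock_Kurzweil_Integration.integral_nonneg integrable_subinterval_real[OF nf]) (use xy in auto)
      then show ?thesis using N e by (simp add: field_simps)
    qed
    finally show "norm (\<Phi> (F y) - \<Phi> (F x) - integral {x..y} (\<lambda>t. D t (f t))) \<le> e * ?N x y" .
  qed
qed

lemma primitive_on_C1:
  fixes q :: "real \<Rightarrow> 'a::euclidean_space"
  assumes "\<And>x. x \<in> {a..b} \<Longrightarrow> (q has_vector_derivative q' x) (at x within {a..b})"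
    and "continuous_on {a..b} q'"
  shows "primitive_on q q' a b"
  unfolding primitive_on_def
proof (intro conjI allI impI)
  show "q' absolutely_integrable_on {a..b}" using assms(2) by (rule absolutely_integrable_continuous_real)
  fix x y assume "a \<le> x" "x \<le> y" "y \<le> b"
  then show "(q' has_integral q y - q x) {x..y}"
    by (intro fundamental_theorem_of_calculus) (auto intro!: has_vector_derivative_within_subset[OF assms(1)])
qed

section \<open>Pairs, products and components of primitives\<close>

lemma has_integral_Pair:
  fixes f :: "real \<Rightarrow> 'a::real_normed_vector" and g :: "real \<Rightarrow> 'b::real_normed_vector"
  assumes "(f has_integral i) S" "(g has_integral j) S"
  shows "((\<lambda>x. (f x, g x)) has_integral (i, j)) S"
proof -
  have "bounded_linear (\<lambda>u::'a. (u, 0::'b))" "bounded_linear (\<lambda>v::'b. (0::'a, v))"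
    by (auto intro!: bounded_linear_Pair bounded_linear_ident bounded_linear_zero)
  from has_integral_add[OF has_integral_linear[OF assms(1) this(1)] has_integral_linear[OF assms(2) this(2)]]
  show ?thesis by (simp add: o_def)
qed

lemma primitive_on_Pair:
  assumes "primitive_on F f a b" "primitive_on G g a b"
  shows "primitive_on (\<lambda>x. (F x, G x)) (\<lambda>x. (f x, g x)) a b"
  unfolding primitive_on_def
proof (intro conjI allI impI)
  have fg: "f absolutely_integrable_on {a..b}" "g absolutely_integrable_on {a..b}"
    using assms by (auto intro: primitive_on_absint)
  show "(\<lambda>x. (f x, g x)) absolutely_integrable_on {a..b}"
  proof (rule absolutely_integrable_integrable_bound)
    show "(\<lambda>x. norm (f x) + norm (g x)) integrable_on {a..b}"
      using fg by (intro integrable_add) (auto simp: absolutely_integrable_on_def)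
    have "f integrable_on {a..b}" "g integrable_on {a..b}" using fg by (auto simp: absolutely_integrable_on_def)
    then show "(\<lambda>x. (f x, g x)) integrable_on {a..b}"
      unfolding integrable_on_def by (blast intro: has_integral_Pair)
  qed (rule norm_Pair_le)
  fix x y assume "a \<le> x" "x \<le> y" "y \<le> b"
  then show "((\<lambda>x. (f x, g x)) has_integral (F y, G y) - (F x, G x)) {x..y}"
    using has_integral_Pair[OF primitive_on_has_integral[OF assms(1), of x y] primitive_on_has_integral[OF assms(2), of x y]]
    by simp
qed

lemma absolutely_integrable_continuous_scaleR:
  fixes g :: "real \<Rightarrow> 'a::euclidean_space"
  assumes "continuous_on {a..b} q" "g absolutely_integrable_on {a..b}"
  shows "(\<lambda>x. q x *\<^sub>R g x) absolutely_integrable_on {a..b}"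
  using assms
  by (intro absolutely_integrable_bounded_measurable_product[where h="\<lambda>x y. x *\<^sub>R y"])
    (auto simp: bilinear_conv_bounded_bilinear bounded_bilinear_scaleR continuous_imp_measurable_on_sets_lebesgue
      intro: compact_imp_bounded compact_continuous_image)

lemma primitive_on_scaleR:
  fixes F :: "real \<Rightarrow> 'a::euclidean_space"
  assumes q: "\<And>x. x \<in> {a..b} \<Longrightarrow> (q has_real_derivative q' x) (at x within {a..b})"
    and q': "continuous_on {a..b} q'" and F: "primitive_on F f a b"
  shows "primitive_on (\<lambda>x. q x *\<^sub>R F x) (\<lambda>x. q x *\<^sub>R f x + q' x *\<^sub>R F x) a b"
proof -
  have qp: "primitive_on q q' a b"
    using q q' by (intro primitive_on_C1) (auto simp: has_real_derivative_iff_has_vector_derivative)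
  have cF: "continuous_on {a..b} F" and cq: "continuous_on {a..b} q"
    using primitive_on_continuous F qp by auto
  \<comment> \<open>\<open>D x\<close> is the derivative of (r, u) \<mapsto> r u at
    \<open>(q x, F x)\<close>: the product rule is the chain rule for scalar multiplication applied
    to the pair.\<close>
  define D :: "real \<Rightarrow> (real \<times> 'a) \<Rightarrow>\<^sub>L 'a" where
    "D x = (blinfun_scaleR_right (q x) o\<^sub>L snd_blinfun) + (blinfun_scaleR_left (F x) o\<^sub>L fst_blinfun)" for x
  have Dap: "D x v = q x *\<^sub>R snd v + fst v *\<^sub>R F x" for x v
    by (simp add: D_def blinfun.add_left)
  have "primitive_on (\<lambda>x. (\<lambda>v. fst v *\<^sub>R snd v) (q x, F x)) (\<lambda>x. D x (q' x, f x)) a b"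
  proof (rule primitive_on_compose[OF primitive_on_Pair[OF qp F]])
    show "((\<lambda>v. fst v *\<^sub>R snd v) has_derivative blinfun_apply (D t)) (at (q t, F t))" for t
      by (auto intro!: derivative_eq_intros simp: Dap fun_eq_iff)
    show "continuous_on {a..b} D" unfolding D_def
      by (intro continuous_intros bounded_linear.continuous_on[OF bounded_linear_blinfun_scaleR_right]
         bounded_linear.continuous_on[OF bounded_linear_blinfun_scaleR_left] cF cq)
    show "(\<lambda>x. D x (q' x, f x)) absolutely_integrable_on {a..b}" unfolding Dap
      using absolutely_integrable_continuous_scaleR[OF cq primitive_on_absint[OF F]]
        absolutely_integrable_continuous_real[OF continuous_on_scaleR[OF q' cF]]
      by (simp add: set_integral_add)
  qed
  then show ?thesis by (simp add: Dap)
qed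

lemma primitive_on_inner:
  assumes "primitive_on F f a b"
  shows "primitive_on (\<lambda>x. F x \<bullet> e) (\<lambda>x. f x \<bullet> e) a b"
  unfolding primitive_on_def
proof (intro conjI allI impI)
  show "(\<lambda>x. f x \<bullet> e) absolutely_integrable_on {a..b}"
    using absolutely_integrable_linear[OF primitive_on_absint[OF assms] bounded_linear_inner_left[of e]] by (simp add: o_def)
  fix x y assume "a \<le> x" "x \<le> y" "y \<le> b"
  then show "((\<lambda>x. f x \<bullet> e) has_integral F y \<bullet> e - F x \<bullet> e) {x..y}"
    using has_integral_linear[OF primitive_on_has_integral[OF assms] bounded_linear_inner_left[of e], of x y]
    by (simp add: o_def inner_diff_left)
qed

section \<open>Weak derivatives on the circle\<close>

text \<open>Lebesgue differentiation: off a null set the value is the limit of averages over short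
  intervals, and these are all zero. Extension by zero outside \<open>{a..b}\<close> keeps every
  integral zero.\<close>

lemma negligible_if_integrals_zero:
  fixes f :: "real \<Rightarrow> 'a::euclidean_space"
  assumes "\<And>x y. a \<le> x \<Longrightarrow> x \<le> y \<Longrightarrow> y \<le> b \<Longrightarrow> (f has_integral 0) {x..y}"
  shows "negligible {x \<in> {a..b}. f x \<noteq> 0}"
proof -
  define g where "g x = (if x \<in> {a..b} then f x else 0)" for x
  have g: "(g has_integral 0) (cbox c d)" for c d
  proof -
    have "(f has_integral 0) ({a..b} \<inter> cbox c d)"
      using assms[of "max a c" "min b d"] by (cases "max a c \<le> min b d") auto
    then show ?thesis unfolding g_def using has_integral_restrict_Int[of "{a..b}" f 0 "cbox c d"] by simp
  qed
  then have "g integrable_on cbox c d" for c d by blast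
  then obtain N where N: "negligible N"
    "\<And>x e. \<lbrakk>x \<notin> N; 0 < e\<rbrakk> \<Longrightarrow> \<exists>d>0. \<forall>h. 0 < h \<and> h < d \<longrightarrow>
       norm (integral (cbox x (x + h *\<^sub>R One)) g /\<^sub>R h ^ DIM(real) - g x) < e"
    using integrable_ccontinuous_explicit[of g] by metis
  have "g x = 0" if x: "x \<notin> N" for x
  proof (rule ccontr)
    assume "g x \<noteq> 0"
    then have "norm (g x) > 0" by simp
    from N(2)[OF x this] obtain d where d: "d > 0" "\<And>h. 0 < h \<Longrightarrow> h < d \<Longrightarrow>
       norm (integral (cbox x (x + h *\<^sub>R One)) g /\<^sub>R h ^ DIM(real) - g x) < norm (g x)" by blast
    from d(2)[of "d/2"] d(1) show False using integral_unique[OF g] by simp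
  qed
  then have "x \<in> N" if "x \<in> {a..b}" "f x \<noteq> 0" for x using that unfolding g_def by metis
  then have "{x \<in> {a..b}. f x \<noteq> 0} \<subseteq> N" by blast
  then show ?thesis using N(1) negligible_subset by blast
qed

lemma set_integrable_lborel_iff:
  fixes f :: "real \<Rightarrow> 'a::euclidean_space"
  assumes "f \<in> borel_measurable lborel"
  shows "set_integrable lborel {a..b} f \<longleftrightarrow> f absolutely_integrable_on {a..b}"
  unfolding set_integrable_def using assms by (subst integrable_completion) auto

subsection \<open>Trigonometric test functions\<close>

text \<open>Test functions need derivatives of all orders. This normal form is closed under
  differentiation because sin^2 = 1 - cos^2, and the centre \<mu> makes an arc around \<mu> a
  superlevel set of the cosine.\<close>

definition trig_poly :: "real \<Rightarrow> (real \<Rightarrow> real) \<Rightarrow> bool" where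
  "trig_poly \<mu> f \<longleftrightarrow> (\<exists>p q. real_polynomial_function p \<and> real_polynomial_function q \<and>
     f = (\<lambda>x. p (cos (2 * pi * (x - \<mu>))) + sin (2 * pi * (x - \<mu>)) * q (cos (2 * pi * (x - \<mu>)))))"

lemma trig_poly_cos: "real_polynomial_function p \<Longrightarrow> trig_poly \<mu> (\<lambda>x. p (cos (2 * pi * (x - \<mu>))))"
  unfolding trig_poly_def
  by (intro exI[of _ p] exI[of _ "\<lambda>x. 0"] conjI) (auto intro: real_polynomial_function.intros(2))

lemma trig_poly_DERIV:
  assumes "trig_poly \<mu> f"
  obtains f' where "trig_poly \<mu> f'" "\<And>x. (f has_real_derivative f' x) (at x)"
proof -
  obtain p q where pq: "real_polynomial_function p" "real_polynomial_function q"
    "f = (\<lambda>x. p (cos (2 * pi * (x - \<mu>))) + sin (2 * pi * (x - \<mu>)) * q (cos (2 * pi * (x - \<mu>))))"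
    using assms by (auto simp: trig_poly_def)
  obtain p' where p': "real_polynomial_function p'" "\<And>x. (p has_real_derivative p' x) (at x)"
    using has_real_derivative_polynomial_function[OF pq(1)] by blast
  obtain q' where q': "real_polynomial_function q'" "\<And>x. (q has_real_derivative q' x) (at x)"
    using has_real_derivative_polynomial_function[OF pq(2)] by blast
  \<comment> \<open>The derivative of p(cos) + sin q(cos), regrouped into its parts even and odd in
    sin; the factor \<open>1 - c * c\<close> is sin^2.\<close>
  define P where "P c = 2 * pi * (c * q c) - 2 * pi * ((1 - c * c) * q' c)" for c
  define Q where "Q c = - (2 * pi) * p' c" for c
  have id: "real_polynomial_function (\<lambda>c::real. c)" by (intro real_polynomial_function.intros(1) bounded_linear_ident)
  have "real_polynomial_function P" "real_polynomial_function Q" unfolding P_def Q_def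
    by (intro real_polynomial_function_diff real_polynomial_function.intros(4) real_polynomial_function.intros(2) id pq p' q')+
  then have "trig_poly \<mu> (\<lambda>x. P (cos (2 * pi * (x - \<mu>))) + sin (2 * pi * (x - \<mu>)) * Q (cos (2 * pi * (x - \<mu>))))"
    unfolding trig_poly_def by blast
  moreover have "(f has_real_derivative P (cos (2 * pi * (x - \<mu>))) + sin (2 * pi * (x - \<mu>)) * Q (cos (2 * pi * (x - \<mu>)))) (at x)" for x
  proof -
    let ?y = "2 * pi * (x - \<mu>)"
    have y: "((\<lambda>x. 2 * pi * (x - \<mu>)) has_real_derivative 2 * pi) (at x)"
      by (auto intro!: derivative_eq_intros)
    have c: "((\<lambda>x. cos (2 * pi * (x - \<mu>))) has_real_derivative - sin ?y * (2 * pi)) (at x)"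
      by (rule DERIV_chain2[OF DERIV_cos y])
    have s: "((\<lambda>x. sin (2 * pi * (x - \<mu>))) has_real_derivative cos ?y * (2 * pi)) (at x)"
      by (rule DERIV_chain2[OF DERIV_sin y])
    have d: "(f has_real_derivative p' (cos ?y) * (- sin ?y * (2 * pi))
       + ((cos ?y * (2 * pi)) * q (cos ?y) + (q' (cos ?y) * (- sin ?y * (2 * pi))) * sin ?y)) (at x)"
      unfolding pq(3) by (intro DERIV_add DERIV_mult s DERIV_chain2[OF p'(2) c] DERIV_chain2[OF q'(2) c])
    have "p' (cos ?y) * (- sin ?y * (2 * pi))
       + ((cos ?y * (2 * pi)) * q (cos ?y) + (q' (cos ?y) * (- sin ?y * (2 * pi))) * sin ?y)
       = p' (cos ?y) * (- sin ?y * (2 * pi)) + (cos ?y * (2 * pi)) * q (cos ?y) - 2 * pi * (sin ?y)\<^sup>2 * q' (cos ?y)"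
      by (simp add: power2_eq_square)
    also have "\<dots> = P (cos ?y) + sin ?y * Q (cos ?y)"
      unfolding sin_squared_eq P_def Q_def by (simp add: power2_eq_square algebra_simps)
    finally show ?thesis using d by (simp only:)
  qed
  ultimately show thesis using that by blast
qed

lemma trig_poly_deriv_funpow: "trig_poly \<mu> f \<Longrightarrow> trig_poly \<mu> ((deriv ^^ j) f)"
proof (induction j)
  case (Suc j)
  then obtain f' where f': "trig_poly \<mu> f'" "\<And>x. ((deriv ^^ j) f has_real_derivative f' x) (at x)"
    using trig_poly_DERIV by metis
  then have "deriv ((deriv ^^ j) f) = f'" by (auto intro: DERIV_imp_deriv)
  then show ?case using f' by simp
qed simp

lemma trig_poly_differentiable: "trig_poly \<mu> f \<Longrightarrow> f field_differentiable (at x)"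
  by (metis trig_poly_DERIV field_differentiable_def)

text \<open>The antiderivative to which this is applied comes from an existence theorem and has no
  explicit form, so smoothness is read off from the first derivative onwards.\<close>

lemma circle_test_if_trig_poly_DERIV:
  assumes "periodic1 \<phi>" "\<And>x. (\<phi> has_real_derivative \<psi> x) (at x)" "trig_poly \<mu> \<psi>"
  shows "circle_test \<phi>"
  unfolding circle_test_def
proof (intro conjI allI)
  have d: "deriv \<phi> = \<psi>" using assms(2) by (auto intro: DERIV_imp_deriv)
  fix j x show "((deriv ^^ j) \<phi>) field_differentiable (at x)"
  proof (cases j)
    case 0 then show ?thesis using assms(2) by (auto simp: field_differentiable_def)
  next
    case (Suc i)
    then have "(deriv ^^ j) \<phi> = (deriv ^^ i) \<psi>" by (simp add: funpow_Suc_right d del: funpow.simps)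
    then show ?thesis using trig_poly_differentiable[OF trig_poly_deriv_funpow[OF assms(3)]] by simp
  qed
qed (rule assms)

lemma circle_test_const: "circle_test (\<lambda>x. c)"
proof (rule circle_test_if_trig_poly_DERIV[where \<psi>="\<lambda>x. 0" and \<mu>=0])
  show "trig_poly 0 (\<lambda>x. 0)" using trig_poly_cos[of "\<lambda>x. 0" 0] by (simp add: real_polynomial_function.intros(2))
qed (auto simp: periodic1_def)

lemma circle_test_DERIV: "circle_test \<phi> \<Longrightarrow> (\<phi> has_real_derivative deriv \<phi> x) (at x)"
proof -
  assume "circle_test \<phi>"
  then have "((deriv ^^ 0) \<phi>) field_differentiable (at x)" unfolding circle_test_def by blast
  then show ?thesis by (simp add: DERIV_deriv_iff_field_differentiable)
qed

lemma circle_test_continuous: "circle_test \<phi> \<Longrightarrow> continuous_on S \<phi>"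
  by (meson circle_test_DERIV DERIV_isCont continuous_at_imp_continuous_on)

lemma circle_test_continuous_deriv: "circle_test \<phi> \<Longrightarrow> continuous_on S (deriv \<phi>)"
proof -
  assume "circle_test \<phi>"
  then have "((deriv ^^ Suc 0) \<phi>) field_differentiable (at x)" for x
    unfolding circle_test_def by blast
  then have "deriv \<phi> field_differentiable (at x)" for x by simp
  then show ?thesis by (meson field_differentiable_imp_continuous_at continuous_at_imp_continuous_on)
qed

text \<open>A periodic function has a periodic antiderivative only if its mean over a period is
  zero, hence the subtracted integral.\<close>

lemma circle_test_primitive:
  assumes p: "real_polynomial_function p"
  obtains \<phi> where "circle_test \<phi>"
    "deriv \<phi> = (\<lambda>x. p (cos (2 * pi * (x - \<mu>))) - integral {0..1} (\<lambda>x. p (cos (2 * pi * (x - \<mu>)))))"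
proof -
  define M where "M = integral {0..1} (\<lambda>x. p (cos (2 * pi * (x - \<mu>))))"
  define \<psi> where "\<psi> x = p (cos (2 * pi * (x - \<mu>))) - M" for x
  have cp: "continuous_on S (\<lambda>x. p (cos (2 * pi * (x - \<mu>))))" for S
  proof -
    have "continuous_on UNIV p" using p continuous_on_polymonial_function real_polynomial_function_eq by blast
    then show ?thesis by (rule continuous_on_compose2) (auto intro!: continuous_intros)
  qed
  then have c\<psi>: "continuous_on S \<psi>" for S unfolding \<psi>_def by (intro continuous_intros)
  have "trig_poly \<mu> \<psi>" unfolding \<psi>_def
    using trig_poly_cos[of "\<lambda>c. p c - M" \<mu>] p by (simp add: real_polynomial_function_diff real_polynomial_function.intros(2))
  have "isCont \<psi> x" for x using c\<psi>[of UNIV] by (simp add: continuous_on_eq_continuous_at)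
  then have "\<exists>\<phi>. \<forall>x. - \<infinity> < ereal x \<longrightarrow> ereal x < \<infinity> \<longrightarrow> (\<phi> has_vector_derivative \<psi> x) (at x)"
    by (intro einterval_antiderivative) simp_all
  then obtain \<phi> where "\<And>x. (\<phi> has_vector_derivative \<psi> x) (at x)" by auto
  then have \<phi>: "\<And>x. (\<phi> has_real_derivative \<psi> x) (at x)"
    by (simp only: has_real_derivative_iff_has_vector_derivative)
  have \<psi>p: "\<psi> (x + 1) = \<psi> x" for x
  proof -
    have "2 * pi * (x + 1 - \<mu>) = 2 * pi * (x - \<mu>) + 2 * pi" by (simp add: algebra_simps)
    then show ?thesis by (simp add: \<psi>_def)
  qed
  have "(\<psi> has_integral \<phi> 1 - \<phi> 0) {0..1}"
  proof (rule fundamental_theorem_of_calculus)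
    show "(\<phi> has_vector_derivative \<psi> x) (at x within {0..1})" for x
      unfolding has_real_derivative_iff_has_vector_derivative[symmetric]
      by (rule has_field_derivative_at_within[OF \<phi>])
  qed simp
  moreover have "(\<psi> has_integral M - M) {0..1}" unfolding \<psi>_def
  proof (intro has_integral_diff)
    show "((\<lambda>x. p (cos (2 * pi * (x - \<mu>)))) has_integral M) {0..1}"
      unfolding M_def by (intro integrable_integral integrable_continuous_real cp)
    show "((\<lambda>x::real. M) has_integral M) {0..1}" using has_integral_const_real[of M 0 1] by simp
  qed
  ultimately have "\<phi> 1 - \<phi> 0 = M - M" by (rule has_integral_unique)
  then have \<phi>1: "\<phi> 1 = \<phi> 0" by simp
  \<comment> \<open>The increment over one period has derivative zero, so it always equals \<phi> 1
    - \<phi> 0, which vanishes because \<psi> has mean zero.\<close>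
  have "((\<lambda>x. \<phi> (x + 1) - \<phi> x) has_real_derivative 0) (at x)" for x
  proof -
    have "((\<lambda>x. \<phi> (x + 1)) has_real_derivative \<psi> (x + 1)) (at x)"
      using \<phi>[of "x + 1"] DERIV_shift[of \<phi> "\<psi> (x + 1)" x 1] by blast
    from DERIV_diff[OF this \<phi>[of x]] show ?thesis by (simp only: \<psi>p diff_self)
  qed
  then have "\<phi> (x + 1) - \<phi> x = \<phi> (0 + 1) - \<phi> 0" for x
    using DERIV_isconst_all[of "\<lambda>x. \<phi> (x + 1) - \<phi> x"] by blast
  then have "periodic1 \<phi>" using \<phi>1 by (auto simp: periodic1_def)
  then have "circle_test \<phi>" by (rule circle_test_if_trig_poly_DERIV[OF _ \<phi> \<open>trig_poly \<mu> \<psi>\<close>])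
  moreover have "deriv \<phi> = \<psi>" using \<phi> by (auto intro: DERIV_imp_deriv)
  ultimately show thesis using that unfolding \<psi>_def M_def by blast
qed

text \<open>The cosine depends only on the distance d to the midpoint and decreases for d up to 1/2.
  Beyond 1/2 it is the cosine belonging to 1 - d, which is still at least the radius r because the
  arc and x lie in [0,1].\<close>

lemma cos_arc_iff:
  assumes "0 \<le> a" "a < b" "b \<le> 1" "0 \<le> x" "x \<le> 1"
  shows "cos (2 * pi * (x - (a + b) / 2)) > cos (2 * pi * ((b - a) / 2)) \<longleftrightarrow> a < x \<and> x < b"
proof -
  define d r where "d = \<bar>x - (a + b) / 2\<bar>" and "r = (b - a) / 2"
  have r: "0 < r" "r \<le> 1/2" "d \<le> 1 - r" "0 \<le> d" using assms by (auto simp: d_def r_def abs_if field_simps)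
  have iff: "d < r \<longleftrightarrow> a < x \<and> x < b" by (auto simp: d_def r_def abs_if field_simps)
  have cd: "cos (2 * pi * (x - (a + b) / 2)) = cos (2 * pi * d)"
  proof -
    have "cos (2 * pi * t) = cos (2 * pi * \<bar>t\<bar>)" for t by (cases "t \<ge> 0") simp_all
    then show ?thesis unfolding d_def .
  qed
  have "cos (2 * pi * d) > cos (2 * pi * r) \<longleftrightarrow> d < r"
  proof (cases "d \<le> 1/2")
    case True
    have "cos (2 * pi * r) < cos (2 * pi * d) \<longleftrightarrow> 2 * pi * d < 2 * pi * r"
      using r True by (intro cos_mono_less_eq) auto
    then show ?thesis by simp
  next
    case False
    have "cos (2 * pi * d) = cos (2 * pi - 2 * pi * d)" by (simp add: cos_diff)
    also have "2 * pi - 2 * pi * d = 2 * pi * (1 - d)" by (simp add: algebra_simps)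
    also have "cos (2 * pi * (1 - d)) \<le> cos (2 * pi * r)"
      using r False by (intro cos_monotone_0_pi_le mult_left_mono) auto
    finally show ?thesis using r False by auto
  qed
  then show ?thesis using iff cd by (simp add: r_def)
qed

text \<open>The indicator of the arc is a pointwise limit of polynomials in the cosine centred at
  its midpoint, and dominated convergence carries the orthogonality over to it.\<close>

lemma integral_zero_if_trig_orthogonal:
  fixes H :: "real \<Rightarrow> 'a::euclidean_space"
  assumes H: "H absolutely_integrable_on {0..1}"
    and orth: "\<And>p \<mu>. real_polynomial_function p \<Longrightarrow>
      ((\<lambda>x. p (cos (2 * pi * (x - \<mu>))) *\<^sub>R H x) has_integral 0) {0..1}"
    and ab: "0 \<le> a" "a \<le> b" "b \<le> 1"
  shows "(H has_integral 0) {a..b}"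
proof (cases "a = b")
  case False
  then have ab': "a < b" using ab by simp
  define \<mu> c where "\<mu> = (a + b) / 2" and "c = cos (2 * pi * ((b - a) / 2))"
  \<comment> \<open>A ramp of slope n that starts at c, the value of the cosine at the ends of the
    arc. With growing n it tends to 1 inside the arc and stays 0 outside; Weierstrass replaces it by
    a polynomial within \<open>1 / real (Suc n)\<close>.\<close>
  define cl where "cl n y = max 0 (min 1 (real n * (y - c)))" for n y
  have "\<forall>n. \<exists>p. real_polynomial_function p \<and> (\<forall>y\<in>{-1..1}. \<bar>cl n y - p y\<bar> < 1 / real (Suc n))"
  proof
    fix n
    have "continuous_on {-1..1} (cl n)" unfolding cl_def by (intro continuous_intros)
    moreover have "0 < 1 / real (Suc n)" by simp
    ultimately obtain g where "real_polynomial_function g" "\<And>y. y \<in> {-1..1} \<Longrightarrow> \<bar>cl n y - g y\<bar> < 1 / real (Suc n)"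
      using Stone_Weierstrass_real_polynomial_function[OF compact_Icc] by blast
    then show "\<exists>p. real_polynomial_function p \<and> (\<forall>y\<in>{-1..1}. \<bar>cl n y - p y\<bar> < 1 / real (Suc n))" by blast
  qed
  from choice[OF this] obtain p where p: "\<And>n. real_polynomial_function (p n)"
    "\<And>n y. y \<in> {-1..1} \<Longrightarrow> \<bar>cl n y - p n y\<bar> < 1 / real (Suc n)" by blast
  let ?y = "\<lambda>x. cos (2 * pi * (x - \<mu>))"
  let ?i = "\<lambda>x. if x \<in> {a<..<b} then H x else 0"
  have y: "?y x \<in> {-1..1}" for x by simp
  have nH: "(\<lambda>x. 2 * norm (H x)) integrable_on {0..1}"
    using H by (intro integrable_on_mult_right) (auto simp: absolutely_integrable_on_def)
  have fi: "(\<lambda>x. p n (?y x) *\<^sub>R H x) integrable_on {0..1}" for n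
    using orth[OF p(1)] by blast
  \<comment> \<open>At most 1 from the clamped ramp and at most 1 from the approximation
    error.\<close>
  have bd: "norm (p n (?y x) *\<^sub>R H x) \<le> 2 * norm (H x)" for n x
  proof -
    have "\<bar>cl n (?y x)\<bar> \<le> 1" unfolding cl_def by (auto simp: max_def min_def)
    moreover have "1 / real (Suc n) \<le> 1" by simp
    ultimately have "\<bar>p n (?y x)\<bar> \<le> 2" using p(2)[OF y, of n x] by linarith
    then show ?thesis unfolding norm_scaleR real_norm_def by (intro mult_right_mono) simp_all
  qed
  have lim: "(\<lambda>n. p n (?y x) *\<^sub>R H x) \<longlonglongrightarrow> ?i x" if x: "x \<in> {0..1}" for x
  proof -
    let ?l = "if x \<in> {a<..<b} then 1 else 0 :: real"
    have iff: "?y x > c \<longleftrightarrow> x \<in> {a<..<b}" using cos_arc_iff[of a b x] ab ab' x by (auto simp: \<mu>_def c_def)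
    have cl: "(\<lambda>n. cl n (?y x)) \<longlonglongrightarrow> ?l"
    proof (cases "x \<in> {a<..<b}")
      case True
      then have pos: "?y x - c > 0" using iff by simp
      obtain N where N: "1 < real N * (?y x - c)" using reals_Archimedean3[OF pos] by metis
      have "cl n (?y x) = 1" if "n \<ge> N" for n
      proof -
        have "real N * (?y x - c) \<le> real n * (?y x - c)" using that pos by (intro mult_right_mono) auto
        then show ?thesis using N unfolding cl_def by simp
      qed
      then show ?thesis using True by (auto intro!: tendsto_eventually eventually_sequentiallyI[of N])
    next
      case False
      then have "?y x - c \<le> 0" using iff by (meson diff_gt_0_iff_gt not_less)
      then have "real n * (?y x - c) \<le> 0" for n by (simp add: mult_nonneg_nonpos)
      then have "cl n (?y x) = 0" for n unfolding cl_def by (simp add: max_absorb1 min.coboundedI2)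
      then show ?thesis using False by auto
    qed
    have "(\<lambda>n. cl n (?y x) - p n (?y x)) \<longlonglongrightarrow> 0"
    proof (rule Lim_null_comparison[of _ "\<lambda>n. 1 / real (Suc n)"])
      show "\<forall>\<^sub>F n in sequentially. norm (cl n (?y x) - p n (?y x)) \<le> 1 / real (Suc n)"
        using p(2)[OF y] by (auto intro!: always_eventually less_imp_le)
      show "(\<lambda>n. 1 / real (Suc n)) \<longlonglongrightarrow> 0" by (rule LIMSEQ_Suc[OF lim_1_over_n])
    qed
    from tendsto_diff[OF cl this] have "(\<lambda>n. p n (?y x)) \<longlonglongrightarrow> ?l" by simp
    then have "(\<lambda>n. p n (?y x) *\<^sub>R H x) \<longlonglongrightarrow> ?l *\<^sub>R H x" by (intro tendsto_intros)
    then show ?thesis by (auto split: if_splits)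
  qed
  have "?i integrable_on {0..1}" "(\<lambda>n. integral {0..1} (\<lambda>x. p n (?y x) *\<^sub>R H x)) \<longlonglongrightarrow> integral {0..1} ?i"
    by (rule dominated_convergence[OF fi nH bd lim]; assumption)+
  moreover have "integral {0..1} (\<lambda>x. p n (?y x) *\<^sub>R H x) = 0" for n
    using orth[OF p(1)] by (rule integral_unique)
  ultimately have "(?i has_integral 0) {0..1}"
    by (simp add: LIMSEQ_const_iff has_integral_iff)
  then have "(H has_integral 0) ({a<..<b} \<inter> {0..1})"
    using has_integral_restrict_Int by blast
  moreover have "{a<..<b} \<inter> {0..1} = {a<..<b}" using ab by auto
  ultimately show ?thesis using has_integral_Icc_iff_Ioo by metis
qed auto

section \<open>Weak derivatives as densities, almost everywhere\<close>

lemma circle_L1_absint: "circle_L1 f \<Longrightarrow> f absolutely_integrable_on {0..1}"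
  using set_integrable_lborel_iff[of f 0 1] by (auto simp: circle_L1_def)

lemma LINT_scaleR_circle_L1:
  fixes f :: "real \<Rightarrow> 'a::euclidean_space"
  assumes "continuous_on UNIV \<phi>" "circle_L1 f"
  shows "(LINT x:{0..1}|lborel. \<phi> x *\<^sub>R f x) = integral {0..1} (\<lambda>x. \<phi> x *\<^sub>R f x)"
proof -
  have f: "f \<in> borel_measurable borel" using assms(2) by (simp add: circle_L1_def)
  have \<phi>: "\<phi> \<in> borel_measurable borel" using assms(1) by (rule borel_measurable_continuous_onI)
  have "(\<lambda>x. \<phi> x *\<^sub>R f x) \<in> borel_measurable lborel"
    using borel_measurable_scaleR[OF \<phi> f] by simp
  moreover have "(\<lambda>x. \<phi> x *\<^sub>R f x) absolutely_integrable_on {0..1}"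
    by (intro absolutely_integrable_continuous_scaleR circle_L1_absint assms continuous_on_subset[OF assms(1)]) simp
  ultimately have "set_integrable lborel {0..1} (\<lambda>x. \<phi> x *\<^sub>R f x)"
    using set_integrable_lborel_iff by blast
  then show ?thesis by (rule set_borel_integral_eq_integral)
qed

lemma has_weak_deriv_integral:
  assumes "f has_weak_deriv g" "circle_test \<phi>"
  shows "integral {0..1} (\<lambda>x. deriv \<phi> x *\<^sub>R f x) = - integral {0..1} (\<lambda>x. \<phi> x *\<^sub>R g x)"
  using assms LINT_scaleR_circle_L1[of "deriv \<phi>" f] LINT_scaleR_circle_L1[of \<phi> g]
    circle_test_continuous circle_test_continuous_deriv
  unfolding has_weak_deriv_def by metis

lemma has_weak_deriv_mean_zero:
  assumes "f has_weak_deriv g" shows "integral {0..1} g = 0"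
  using has_weak_deriv_integral[OF assms circle_test_const[of 1]] by simp

lemma primitive_on_integral:
  fixes g :: "real \<Rightarrow> 'a::euclidean_space"
  assumes "g absolutely_integrable_on {a..b}"
  shows "primitive_on (\<lambda>x. C + integral {a..x} g) g a b"
  unfolding primitive_on_def
proof (intro conjI allI impI)
  fix x y assume xy: "a \<le> x" "x \<le> y" "y \<le> b"
  have "g integrable_on {a..b}" using assms by (simp add: absolutely_integrable_on_def)
  then have i: "g integrable_on {a..y}" "g integrable_on {x..y}"
    using xy by (auto intro: integrable_subinterval_real)
  have "integral {a..x} g + integral {x..y} g = integral {a..y} g"
    using xy i by (intro Henstock_Kurzweil_Integration.integral_combine) auto
  then have e: "C + integral {a..y} g - (C + integral {a..x} g) = integral {x..y} g"
    by (simp add: algebra_simps)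
  show "(g has_integral C + integral {a..y} g - (C + integral {a..x} g)) {x..y}"
    unfolding e using i(2) by (rule integrable_integral)
qed (rule assms)

text \<open>Du Bois-Reymond: testing with trigonometric polynomials determines \<open>f - \<integral>g\<close> up to a constant.\<close>

lemma has_weak_deriv_ae_integral:
  fixes f :: "real \<Rightarrow> 'a::euclidean_space"
  assumes fg: "f has_weak_deriv g"
  shows "\<exists>C. negligible {x \<in> {0..1}. f x \<noteq> C + integral {0..x} g}"
proof -
  have f: "f absolutely_integrable_on {0..1}" and g: "g absolutely_integrable_on {0..1}"
    using fg by (auto simp: has_weak_deriv_def intro: circle_L1_absint)
  define G where "G x = 0 + integral {0..x} g" for x
  have pG: "primitive_on G g 0 1" unfolding G_def by (rule primitive_on_integral[OF g])
  have G01: "G 0 = 0" "G 1 = 0" using has_weak_deriv_mean_zero[OF fg] by (simp_all add: G_def)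
  have cG: "continuous_on {0..1} G" by (rule primitive_on_continuous[OF pG])
  have Gi: "G absolutely_integrable_on {0..1}" by (rule absolutely_integrable_continuous_real[OF cG])
  define h where "h x = f x - G x" for x
  have h: "h absolutely_integrable_on {0..1}" unfolding h_def by (rule set_integral_diff(1)[OF f Gi])
  have hi: "h integrable_on {0..1}" using h by (simp add: absolutely_integrable_on_def)
  \<comment> \<open>Integration by parts for \<phi> G has no boundary term, as \<open>G\<close>
    vanishes at 0 and 1. Combined with the weak derivative this makes h = f - G orthogonal to all
    derivatives of test functions.\<close>
  have test: "((\<lambda>x. deriv \<phi> x *\<^sub>R h x) has_integral 0) {0..1}" if \<phi>: "circle_test \<phi>" for \<phi>
  proof -
    have "primitive_on (\<lambda>x. \<phi> x *\<^sub>R G x) (\<lambda>x. \<phi> x *\<^sub>R g x + deriv \<phi> x *\<^sub>R G x) 0 1"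
      by (intro primitive_on_scaleR has_field_derivative_at_within[OF circle_test_DERIV[OF \<phi>]]
        circle_test_continuous_deriv \<phi> pG)
    from primitive_on_has_integral[OF this, of 0 1]
    have 1: "((\<lambda>x. \<phi> x *\<^sub>R g x + deriv \<phi> x *\<^sub>R G x) has_integral 0) {0..1}" by (simp add: G01)
    have i: "(\<lambda>x. deriv \<phi> x *\<^sub>R f x) integrable_on {0..1}" "(\<lambda>x. \<phi> x *\<^sub>R g x) integrable_on {0..1}"
      using absolutely_integrable_continuous_scaleR[OF circle_test_continuous_deriv[OF \<phi>] f]
        absolutely_integrable_continuous_scaleR[OF circle_test_continuous[OF \<phi>] g]
      by (simp_all add: absolutely_integrable_on_def)
    have 2: "((\<lambda>x. deriv \<phi> x *\<^sub>R f x) has_integral - integral {0..1} (\<lambda>x. \<phi> x *\<^sub>R g x)) {0..1}"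
      using integrable_integral[OF i(1)] unfolding has_weak_deriv_integral[OF fg \<phi>] .
    have "((\<lambda>x. deriv \<phi> x *\<^sub>R f x + \<phi> x *\<^sub>R g x - (\<phi> x *\<^sub>R g x + deriv \<phi> x *\<^sub>R G x)) has_integral
       - integral {0..1} (\<lambda>x. \<phi> x *\<^sub>R g x) + integral {0..1} (\<lambda>x. \<phi> x *\<^sub>R g x) - 0) {0..1}"
      by (intro has_integral_diff has_integral_add 1 2 integrable_integral i)
    then show ?thesis by (simp add: h_def scaleR_diff_right)
  qed
  \<comment> \<open>Derivatives of test functions have mean zero, so they only see h up to a
    constant. With M the mean of p, \<integral> p H = \<integral> (p - M) h + M \<integral> h - C
    \<integral> p, where the first term is zero and the last two cancel.\<close>
  define C where "C = integral {0..1} h"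
  define H where "H x = h x - C" for x
  have H: "H absolutely_integrable_on {0..1}" unfolding H_def by (intro set_integral_diff(1) h) simp
  have "((\<lambda>x. p (cos (2 * pi * (x - \<mu>))) *\<^sub>R H x) has_integral 0) {0..1}"
    if p: "real_polynomial_function p" for p \<mu>
  proof -
    let ?p = "\<lambda>x. p (cos (2 * pi * (x - \<mu>)))"
    define M where "M = integral {0..1} ?p"
    obtain \<phi> where \<phi>: "circle_test \<phi>" "deriv \<phi> = (\<lambda>x. ?p x - M)"
      unfolding M_def by (rule circle_test_primitive[OF p, of \<mu>])
    have "continuous_on {0..1} (\<lambda>x. deriv \<phi> x + M)" by (intro continuous_intros circle_test_continuous_deriv \<phi>)
    then have "(?p has_integral M) {0..1}" unfolding M_def \<phi>(2)
      by (intro integrable_integral integrable_continuous_real) simp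
    then have "((\<lambda>x. ?p x *\<^sub>R C) has_integral M *\<^sub>R C) {0..1}" by (rule has_integral_scaleR_left)
    moreover have "((\<lambda>x. (?p x - M) *\<^sub>R h x) has_integral 0) {0..1}" using test[OF \<phi>(1)] unfolding \<phi>(2) .
    moreover have "((\<lambda>x. M *\<^sub>R h x) has_integral M *\<^sub>R C) {0..1}"
      unfolding C_def by (intro has_integral_cmul integrable_integral hi)
    ultimately have "((\<lambda>x. (?p x - M) *\<^sub>R h x + M *\<^sub>R h x - ?p x *\<^sub>R C) has_integral 0 + M *\<^sub>R C - M *\<^sub>R C) {0..1}"
      by (intro has_integral_diff has_integral_add)
    moreover have "(?p x - M) *\<^sub>R h x + M *\<^sub>R h x - ?p x *\<^sub>R C = ?p x *\<^sub>R H x" for x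
      by (simp add: H_def scaleR_diff_left scaleR_diff_right)
    ultimately show ?thesis by simp
  qed
  then have "(H has_integral 0) {x..y}" if "0 \<le> x" "x \<le> y" "y \<le> 1" for x y
    using integral_zero_if_trig_orthogonal[OF H _ that] by blast
  then have "negligible {x \<in> {0..1}. H x \<noteq> 0}" by (intro negligible_if_integrals_zero)
  moreover have "H x = 0 \<longleftrightarrow> f x = C + integral {0..x} g" for x
  proof -
    have "H x = f x - (C + integral {0..x} g)" by (simp add: H_def h_def G_def)
    then show ?thesis by simp
  qed
  ultimately have "negligible {x \<in> {0..1}. f x \<noteq> C + integral {0..x} g}" by simp
  then show ?thesis by blast
qed

subsection \<open>Periodic primitives\<close>

lemma periodic1_nat: "periodic1 f \<Longrightarrow> f (x + real n) = f x"
proof (induction n)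
  case (Suc n)
  have "f (x + real (Suc n)) = f ((x + real n) + 1)" by (simp add: algebra_simps)
  then show ?case using Suc by (simp add: periodic1_def)
qed simp

lemma periodic1_int: assumes "periodic1 f" shows "f (x + of_int n) = f x"
proof (cases n)
  case (nonneg k) then show ?thesis using periodic1_nat[OF assms] by simp
next
  case (neg k)
  have "f x = f (x + of_int n + real (Suc k))" unfolding neg by simp
  also have "\<dots> = f (x + of_int n)" by (rule periodic1_nat[OF assms])
  finally show ?thesis by simp
qed

lemma has_integral_periodic_shift:
  fixes f :: "real \<Rightarrow> 'a::real_normed_vector"
  assumes "periodic1 f" "(f has_integral I) {a..b}"
  shows "(f has_integral I) {a + of_int n..b + of_int n}"
  using has_integral_shift_real_ivl[OF assms(2), of "- of_int n"] periodic1_int[OF assms(1), of _ "- n"] by simp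

lemma integrable_periodic:
  fixes f :: "real \<Rightarrow> 'a::euclidean_space"
  assumes p: "periodic1 f" and f: "f integrable_on {0..1}"
  shows "f integrable_on {a..b}"
proof -
  obtain I where I: "(f has_integral I) {0..1}" using f by blast
  have nat: "f integrable_on {0..real k}" for k
  proof (induction k)
    case (Suc k)
    have "(f has_integral I) {real k..real (Suc k)}"
      using has_integral_periodic_shift[OF p I, of "int k"] by (simp add: algebra_simps)
    then have "f integrable_on {real k..real (Suc k)}" by blast
    from Henstock_Kurzweil_Integration.integrable_combine[OF _ _ Suc this] show ?case by simp
  qed (use integrable_on_refl[of f "0::real"] in simp)
  obtain N :: nat where N: "max \<bar>a\<bar> \<bar>b\<bar> \<le> real N" using real_arch_simple by blast
  obtain J where "(f has_integral J) {0..real (2 * N)}" using nat[of "2 * N"] by blast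
  from has_integral_periodic_shift[OF p this, of "- int N"]
  have "(f has_integral J) {- real N..real N}" by simp
  then have "f integrable_on {- real N..real N}" by blast
  moreover have "{a..b} \<subseteq> {- real N..real N}" using N by (auto simp: abs_le_iff)
  ultimately show ?thesis by (rule integrable_subinterval_real)
qed

lemma absolutely_integrable_periodic:
  fixes f :: "real \<Rightarrow> 'a::euclidean_space"
  assumes "periodic1 f" "f absolutely_integrable_on {0..1}"
  shows "f absolutely_integrable_on {a..b}"
  using integrable_periodic[of f a b] integrable_periodic[of "\<lambda>x. norm (f x)" a b] assms
  by (auto simp: absolutely_integrable_on_def periodic1_def)

text \<open>Mean zero is what prevents a jump of \<open>F\<close> at the integers, where
  \<open>frac\<close> drops to 0. The formula holds on each closed unit interval and is glued across
  integers by bisection.\<close>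

lemma primitive_periodic:
  fixes g :: "real \<Rightarrow> 'a::euclidean_space" and C :: 'a
  assumes g: "periodic1 g" "g absolutely_integrable_on {0..1}" and int0: "integral {0..1} g = 0"
  defines "F \<equiv> \<lambda>x. C + integral {0..frac x} g"
  shows "primitive_on F g a b"
  unfolding primitive_on_def
proof (intro conjI allI impI)
  show "g absolutely_integrable_on {a..b}" by (rule absolutely_integrable_periodic[OF g])
  have unit: "(g has_integral (F v - F u)) {u..v}" if "of_int n \<le> u" "u \<le> v" "v \<le> of_int n + 1" for n u v
  proof -
    have "(g has_integral (C + integral {0..v - of_int n} g - (C + integral {0..u - of_int n} g))) {u - of_int n..v - of_int n}"
      by (rule primitive_on_has_integral[OF primitive_on_integral[OF g(2)]]) (use that in auto)
    from has_integral_periodic_shift[OF g(1) this, of n]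
    have 1: "(g has_integral (C + integral {0..v - of_int n} g - (C + integral {0..u - of_int n} g))) {u..v}" by simp
    \<comment> \<open>At the right endpoint \<open>frac\<close> has already returned to 0;
      \<open>int0\<close> supplies the same value.\<close>
    have "F x = C + integral {0..x - of_int n} g" if x: "of_int n \<le> x" "x \<le> of_int n + 1" for x
    proof (cases "x = of_int n + 1")
      case True
      then have "frac x = 0" by simp
      then show ?thesis using True int0 by (simp add: F_def)
    next
      case False
      then have "\<lfloor>x\<rfloor> = n" using x by (simp add: floor_eq_iff)
      then show ?thesis by (simp add: F_def frac_def)
    qed
    with 1 that show ?thesis by simp
  qed
  fix x y :: real assume "x \<le> y"
  then show "(g has_integral (F y - F x)) {x..y}"
  proof (induction rule: Bolzano)
    case (trans u v w)
    from has_integral_combine[OF trans(3,4,1,2)] show ?case by simp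
  next
    case (local t)
    let ?n = "\<lfloor>t\<rfloor>"
    show ?case
    proof (cases "t = of_int ?n")
      \<comment> \<open>At an integer two unit intervals meet, and each side is treated in its
        own.\<close>
      case True
      have "(g has_integral (F v - F u)) {u..v}" if "u \<le> t" "t \<le> v" "v - u < 1" for u v
      proof -
        have "(g has_integral (F t - F u)) {u..t}" using True that by (intro unit[of "?n - 1"]) auto
        moreover have "(g has_integral (F v - F t)) {t..v}" using True that by (intro unit[of "?n"]) auto
        ultimately show ?thesis using has_integral_combine[of u t v g] that by fastforce
      qed
      then show ?thesis by (intro exI[of _ 1]) auto
    next
      case False
      define d where "d = min (t - of_int ?n) (of_int ?n + 1 - t)"
      have "of_int ?n \<le> t" "t < of_int ?n + 1" by linarith+
      then have "d > 0" unfolding d_def using False by linarith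
      moreover have "(g has_integral (F v - F u)) {u..v}" if "u \<le> t" "t \<le> v" "v - u < d" for u v
        using that unfolding d_def by (intro unit[of ?n]) linarith+
      ultimately show ?thesis by blast
    qed
  qed
qed

text \<open>After subtraction of the mean there is a periodic primitive, and it takes equal values
  at a and a + 1.\<close>

lemma integral_periodic_period:
  fixes f :: "real \<Rightarrow> 'a::euclidean_space"
  assumes p: "periodic1 f" and f: "f absolutely_integrable_on {0..1}"
  shows "integral {a..a + 1} f = integral {0..1} f"
proof -
  define M where "M = integral {0..1} f"
  have fi: "f integrable_on {0..1}" using f by (simp add: absolutely_integrable_on_def)
  have "((\<lambda>x. f x - M) has_integral M - M) {0..1}"
    using has_integral_diff[OF integrable_integral[OF fi] has_integral_const_real[of M 0 1]] by (simp add: M_def)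
  then have "integral {0..1} (\<lambda>x. f x - M) = 0" by (simp add: integral_unique)
  moreover have "periodic1 (\<lambda>x. f x - M)" using p by (simp add: periodic1_def)
  moreover have "(\<lambda>x. f x - M) absolutely_integrable_on {0..1}" by (intro set_integral_diff(1) f) simp
  ultimately have "primitive_on (\<lambda>x. 0 + integral {0..frac x} (\<lambda>x. f x - M)) (\<lambda>x. f x - M) a (a + 1)"
    by (intro primitive_periodic)
  from primitive_on_has_integral[OF this, of a "a + 1"]
  have 0: "((\<lambda>x. f x - M) has_integral 0) {a..a + 1}" by (simp add: frac_1_eq)
  from has_integral_add[OF 0 has_integral_const_real[of M a "a + 1"]]
  have "((\<lambda>x. f x) has_integral M) {a..a + 1}" by simp
  then show ?thesis by (simp add: M_def integral_unique)
qed

lemma negligible_periodic: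
  assumes "\<And>x. P (x + 1) \<longleftrightarrow> P x" "negligible {x \<in> {0..1}. P x}"
  shows "negligible {x::real. P x}"
proof -
  have pP: "periodic1 P" using assms(1) by (simp add: periodic1_def)
  have "negligible (\<Union>n. (+) (real_of_int n) ` {x \<in> {0..1}. P x})"
  proof (intro negligible_countable_Union countable_image)
    fix S assume "S \<in> range (\<lambda>n. (+) (real_of_int n) ` {x \<in> {0..1}. P x})"
    then show "negligible S" using negligible_translation[OF assms(2)] by blast
  qed simp
  moreover have "{x. P x} \<subseteq> (\<Union>n. (+) (real_of_int n) ` {x \<in> {0..1}. P x})"
  proof
    fix x assume "x \<in> {x. P x}"
    then have "P (frac x)" using periodic1_int[OF pP, of x "- \<lfloor>x\<rfloor>"] by (simp add: frac_def)
    moreover have "x = real_of_int \<lfloor>x\<rfloor> + frac x" by (simp add: frac_def)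
    moreover have "frac x \<in> {0..1}" by (simp add: frac_lt_1 less_imp_le)
    ultimately show "x \<in> (\<Union>n. (+) (real_of_int n) ` {x \<in> {0..1}. P x})" by blast
  qed
  ultimately show ?thesis using negligible_subset by blast
qed

text \<open>Supplies the absolutely continuous periodic representative of \<open>f\<close>. Its
  density relation holds on every interval, in particular across the base point of the
  circle.\<close>

lemma has_weak_deriv_primitive:
  fixes f :: "real \<Rightarrow> 'a::euclidean_space"
  assumes fg: "f has_weak_deriv g"
  obtains F where "periodic1 F" "\<And>a b. primitive_on F g a b" "negligible {x. f x \<noteq> F x}"
proof -
  obtain C where C: "negligible {x \<in> {0..1}. f x \<noteq> C + integral {0..x} g}"
    using has_weak_deriv_ae_integral[OF fg] by blast
  have g: "periodic1 g" "g absolutely_integrable_on {0..1}" and pf: "periodic1 f"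
    using fg by (auto simp: has_weak_deriv_def circle_L1_def intro: circle_L1_absint)
  note mean = has_weak_deriv_mean_zero[OF fg]
  define F where "F x = C + integral {0..frac x} g" for x
  have F: "primitive_on F g a b" for a b
    unfolding F_def by (rule primitive_periodic[OF g mean])
  have pF: "periodic1 F" by (simp add: periodic1_def F_def frac_1_eq)
  have Feq: "F x = C + integral {0..x} g" if "x \<in> {0..1}" for x
  proof (cases "x = 1")
    case False
    then have "frac x = x" using that by (simp add: frac_eq)
    then show ?thesis by (simp add: F_def)
  qed (simp add: F_def mean)
  have "negligible {x. f x \<noteq> F x}"
  proof (rule negligible_periodic)
    show "f (x + 1) \<noteq> F (x + 1) \<longleftrightarrow> f x \<noteq> F x" for x using pf pF by (simp add: periodic1_def)
    have "{x \<in> {0..1}. f x \<noteq> F x} = {x \<in> {0..1}. f x \<noteq> C + integral {0..x} g}" using Feq by auto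
    then show "negligible {x \<in> {0..1}. f x \<noteq> F x}" using C by simp
  qed
  then show thesis using that pF F by blast
qed

lemma continuous_eq_if_negligible:
  fixes f g :: "real \<Rightarrow> 'a::euclidean_space"
  assumes "continuous_on UNIV f" "continuous_on UNIV g" "negligible {x. f x \<noteq> g x}"
  shows "f = g"
proof -
  have "open {x. f x - g x \<in> - {0}}"
    using open_vimage[of "- {0}" "\<lambda>x. f x - g x"] assms(1,2)
    by (auto simp: vimage_def intro!: continuous_intros)
  then have "open {x. f x \<noteq> g x}" by simp
  then have "{x. f x \<noteq> g x} = {}" using open_not_negligible assms(3) by blast
  then show ?thesis by auto
qed

section \<open>Elliptic integrals and the amplitude\<close>

text \<open>Jacobi's delta amplitude: dn as a function of the amplitude t.\<close>

definition modulus :: "real \<Rightarrow> real \<Rightarrow> real" where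
  "modulus m t = sqrt (1 - m * (sin t)\<^sup>2)"

lemma one_minus_m_sin_pos:
  assumes "0 < m" "m < (1::real)" shows "1 - m * (sin t)\<^sup>2 > 0"
proof -
  have "(sin t)\<^sup>2 \<le> 1" by (simp add: abs_square_le_1)
  then have "m * (sin t)\<^sup>2 \<le> m" using assms by (simp add: mult_left_le)
  then show ?thesis using assms by linarith
qed

lemma modulus_pos: "0 < m \<Longrightarrow> m < 1 \<Longrightarrow> modulus m t > 0"
  using one_minus_m_sin_pos[of m t] by (simp add: modulus_def)

lemma modulus_nonzero: "0 < m \<Longrightarrow> m < 1 \<Longrightarrow> modulus m t \<noteq> 0"
  using modulus_pos[of m t] by simp

lemma modulus_le_1: "0 < m \<Longrightarrow> modulus m t \<le> 1"
  by (simp add: modulus_def)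

lemma modulus_sq: "0 < m \<Longrightarrow> m < 1 \<Longrightarrow> (modulus m t)\<^sup>2 = 1 - m * (sin t)\<^sup>2"
  using one_minus_m_sin_pos[of m t] by (simp add: modulus_def)

lemma continuous_modulus [continuous_intros]:
  fixes f :: "real \<Rightarrow> real"
  shows "continuous_on S f \<Longrightarrow> continuous_on S (\<lambda>x. modulus m (f x))"
  unfolding modulus_def by (intro continuous_intros)

lemma DERIV_modulus:
  assumes "0 < m" "m < 1"
  shows "(modulus m has_real_derivative (- m * sin t * cos t / modulus m t)) (at t within S)"
  unfolding modulus_def
  using one_minus_m_sin_pos[OF assms, of t]
  by (auto intro!: derivative_eq_intros simp: field_simps)

lemma DERIV_modulus_compose [derivative_intros]:
  assumes "0 < m" "m < 1" "(f has_real_derivative f') (at x within S)"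
  shows "((\<lambda>x. modulus m (f x)) has_real_derivative (- m * sin (f x) * cos (f x) / modulus m (f x) * f')) (at x within S)"
  using DERIV_chain2[OF DERIV_modulus[OF assms(1,2)] assms(3)] .

lemma LINT_continuous_has_integral:
  fixes f :: "real \<Rightarrow> real"
  assumes "continuous_on {a..b} f"
  shows "(f has_integral (LINT x:{a..b}|lborel. f x)) {a..b}"
  using set_borel_integral_eq_integral[OF borel_integrable_atLeastAtMost'[OF assms]]
  by (metis integrable_integral)

lemma ellipticK_has_integral:
  assumes "0 < m" "m < 1"
  shows "((\<lambda>t. 1 / modulus m t) has_integral ellipticK m) {0..pi/2}"
  unfolding ellipticK_def modulus_def[symmetric]
  by (intro LINT_continuous_has_integral continuous_intros)
    (metis assms modulus_pos less_irrefl)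

lemma ellipticE_has_integral:
  "((\<lambda>t. modulus m t) has_integral ellipticE m) {0..pi/2}"
  unfolding ellipticE_def modulus_def[symmetric]
  by (intro LINT_continuous_has_integral continuous_intros)

text \<open>The quarter-period integral of the error term of the calibration. The derivative of m
  sin t cos t / modulus, whose boundary values vanish, reduces it to \<open>ellipticK\<close> and
  \<open>ellipticE\<close>.\<close>

lemma elliptic_J_has_integral:
  assumes m: "0 < m" "m < 1"
  shows "((\<lambda>t. m\<^sup>2 * (sin t)\<^sup>2 * (cos t)\<^sup>2 / (modulus m t)^3) has_integral
      (2 - m) * ellipticK m - 2 * ellipticE m) {0..pi/2}"
proof -
  note K = ellipticK_has_integral[OF m] and E = ellipticE_has_integral[of m]
  have "((\<lambda>t. m * (((cos t)\<^sup>2 - (sin t)\<^sup>2) / modulus m t + m * (sin t)\<^sup>2 * (cos t)\<^sup>2 / modulus m t ^ 3)) has_integral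
      (m * (sin (pi/2) * cos (pi/2) / modulus m (pi/2)) - m * (sin 0 * cos 0 / modulus m 0))) {0..pi/2}"
  proof (rule fundamental_theorem_of_calculus)
    fix t :: real
    have "modulus m t > 0" using modulus_pos m by blast
    then show "((\<lambda>t. m * (sin t * cos t / modulus m t)) has_vector_derivative
        m * (((cos t)\<^sup>2 - (sin t)\<^sup>2) / modulus m t + m * (sin t)\<^sup>2 * (cos t)\<^sup>2 / modulus m t ^ 3)) (at t within {0..pi/2})"
      unfolding has_real_derivative_iff_has_vector_derivative[symmetric]
      by (auto intro!: derivative_eq_intros m simp: field_simps power2_eq_square power3_eq_cube)
  qed simp
  then have 1: "((\<lambda>t. m * (((cos t)\<^sup>2 - (sin t)\<^sup>2) / modulus m t + m * (sin t)\<^sup>2 * (cos t)\<^sup>2 / modulus m t ^ 3)) has_integral 0) {0..pi/2}"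
    by simp
  have "((\<lambda>t. m * (((cos t)\<^sup>2 - (sin t)\<^sup>2) / modulus m t + m * (sin t)\<^sup>2 * (cos t)\<^sup>2 / modulus m t ^ 3)
     + (2 - m) * (1 / modulus m t) - 2 * modulus m t) has_integral 0 + (2 - m) * ellipticK m - 2 * ellipticE m) {0..pi/2}"
    by (intro has_integral_add has_integral_diff 1 has_integral_mult_right K E)
  moreover have "m * (((cos t)\<^sup>2 - (sin t)\<^sup>2) / modulus m t + m * (sin t)\<^sup>2 * (cos t)\<^sup>2 / modulus m t ^ 3)
     + (2 - m) * (1 / modulus m t) - 2 * modulus m t = m\<^sup>2 * (sin t)\<^sup>2 * (cos t)\<^sup>2 / (modulus m t)^3" for t
  proof -
    have p: "modulus m t > 0" using modulus_pos m by blast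
    have "m * ((cos t)\<^sup>2 - (sin t)\<^sup>2) + (2 - m) = 2 * (modulus m t)\<^sup>2"
      unfolding modulus_sq[OF m] by (simp add: cos_squared_eq algebra_simps)
    then have "2 * modulus m t = (m * ((cos t)\<^sup>2 - (sin t)\<^sup>2) + (2 - m)) / modulus m t"
      using p by (simp add: power2_eq_square)
    then show ?thesis
      by (simp add: add_divide_distrib distrib_left power2_eq_square mult.assoc)
  qed
  ultimately show ?thesis by simp
qed

section \<open>Existence and uniqueness of the parameter with K = 2E\<close>

lemma elliptic_gap_has_integral:
  assumes "0 < m" "m < 1"
  shows "((\<lambda>t. 1 / modulus m t - 2 * modulus m t) has_integral ellipticK m - 2 * ellipticE m) {0..pi/2}"
  by (intro has_integral_diff has_integral_mult_right ellipticK_has_integral ellipticE_has_integral assms)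

lemma continuous_on_gap_integrand:
  "0 < m \<Longrightarrow> m < 1 \<Longrightarrow> continuous_on S (\<lambda>t. 1 / modulus m t - 2 * modulus m t)"
  by (intro continuous_intros ballI modulus_nonzero)

text \<open>For 0 < t < pi/2 the modulus decreases in m, and 1/x - 2x decreases in x > 0, so the
  integrand grows pointwise. This gives the uniqueness behind \<open>m_star\<close>.\<close>

lemma elliptic_gap_strict_mono:
  assumes m: "0 < m" "m < m'" "m' < 1"
  shows "ellipticK m - 2 * ellipticE m < ellipticK m' - 2 * ellipticE m'"
proof -
  have "integral {0..pi/2} (\<lambda>t. 1 / modulus m t - 2 * modulus m t)
      < integral {0..pi/2} (\<lambda>t. 1 / modulus m' t - 2 * modulus m' t)"
  proof (rule integral_less_real)
    show "continuous_on {0..pi/2} (\<lambda>t. 1 / modulus m t - 2 * modulus m t)"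
      "continuous_on {0..pi/2} (\<lambda>t. 1 / modulus m' t - 2 * modulus m' t)"
      using m continuous_on_gap_integrand[of m] continuous_on_gap_integrand[of m'] by simp_all
    show "{0<..<pi/2} \<noteq> {}" using pi_gt_zero by (simp add: not_le)
    fix t :: real assume "t \<in> {0<..<pi/2}"
    then have "sin t > 0" by (auto intro!: sin_gt_zero)
    then have "m * (sin t)\<^sup>2 < m' * (sin t)\<^sup>2" using m by simp
    then have "modulus m' t < modulus m t" by (simp add: modulus_def)
    moreover have "modulus m' t > 0" using m by (intro modulus_pos) auto
    ultimately show "1 / modulus m t - 2 * modulus m t < 1 / modulus m' t - 2 * modulus m' t"
      using frac_less2[of 1 1 "modulus m' t" "modulus m t"] by linarith
  qed
  then show ?thesis
    using integral_unique[OF elliptic_gap_has_integral[of m]] integral_unique[OF elliptic_gap_has_integral[of m']] m by simp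
qed

lemma continuous_on_elliptic_gap: "continuous_on {0<..<1} (\<lambda>m. ellipticK m - 2 * ellipticE m)"
proof -
  have cm: "continuous_on ({0<..<1} \<times> cbox 0 (pi/2)) (\<lambda>x. modulus (fst x) (snd x))"
    unfolding modulus_def by (intro continuous_on_real_sqrt continuous_intros)
  have "modulus (fst x) (snd x) \<noteq> 0" if "x \<in> {0<..<1} \<times> cbox 0 (pi/2)" for x
    using modulus_nonzero[of "fst x" "snd x"] that by (simp add: mem_Times_iff)
  with cm have "continuous_on ({0<..<1} \<times> cbox 0 (pi/2)) (\<lambda>x. 1 / modulus (fst x) (snd x) - 2 * modulus (fst x) (snd x))"
    by (intro continuous_on_diff continuous_on_divide continuous_on_mult continuous_on_const) auto
  then have "continuous_on {0<..<1} (\<lambda>m. integral (cbox 0 (pi/2)) (\<lambda>t. 1 / modulus m t - 2 * modulus m t))"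
    by (intro integral_continuous_on_param) (simp add: case_prod_unfold)
  moreover have "integral (cbox 0 (pi/2)) (\<lambda>t. 1 / modulus m t - 2 * modulus m t) = ellipticK m - 2 * ellipticE m"
    if "m \<in> {0<..<1}" for m
    using integral_unique[OF elliptic_gap_has_integral[of m]] that by simp
  ultimately show ?thesis
    by (simp cong: continuous_on_cong_simp)
qed

lemma ellipticE_le: assumes "0 < m" shows "ellipticE m \<le> pi/2"
proof -
  have "((\<lambda>t::real. 1::real) has_integral pi/2) {0..pi/2}" using has_integral_const_real[of "1::real" 0 "pi/2"] by simp
  from has_integral_le[OF ellipticE_has_integral this] show ?thesis using modulus_le_1[OF assms] by blast
qed

text \<open>Near \<open>m = 1\<close> the bound \<open>sqrt (1 - m) + pi/2 - t\<close> of the modulus makes \<open>K\<close> logarithmically large.\<close>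

lemma ellipticK_ge:
  assumes "0 < \<eta>" "\<eta> < 1"
  shows "ellipticK (1 - \<eta>\<^sup>2) \<ge> ln (\<eta> + pi/2) - ln \<eta>"
proof -
  let ?m = "1 - \<eta>\<^sup>2"
  have m: "0 < ?m" "?m < 1" using assms by (auto simp: power_less_one_iff abs_square_less_1)
  have "((\<lambda>t. 1 / (\<eta> + pi/2 - t)) has_integral (- ln (\<eta> + pi/2 - pi/2)) - (- ln (\<eta> + pi/2 - 0))) {0..pi/2}"
  proof (rule fundamental_theorem_of_calculus)
    fix t assume "t \<in> {0..pi/2}"
    then show "((\<lambda>t. - ln (\<eta> + pi/2 - t)) has_vector_derivative 1 / (\<eta> + pi/2 - t)) (at t within {0..pi/2})"
      unfolding has_real_derivative_iff_has_vector_derivative[symmetric]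
      using assms by (auto intro!: derivative_eq_intros simp: field_simps)
  qed simp
  then have 1: "((\<lambda>t. 1 / (\<eta> + pi/2 - t)) has_integral ln (\<eta> + pi/2) - ln \<eta>) {0..pi/2}" by simp
  show ?thesis
  proof (rule has_integral_le[OF 1 ellipticK_has_integral[OF m]])
    fix t assume t: "t \<in> {0..pi/2}"
    have c: "0 \<le> cos t" "cos t \<le> pi/2 - t"
      using t cos_ge_zero[of t] sin_x_le_x[of "pi/2 - t"] by (auto simp: sin_diff)
    have "(modulus ?m t)\<^sup>2 = \<eta>\<^sup>2 * (sin t)\<^sup>2 + (cos t)\<^sup>2"
      unfolding modulus_sq[OF m] by (simp add: cos_squared_eq algebra_simps)
    also have "\<dots> \<le> \<eta>\<^sup>2 * 1 + (pi/2 - t)\<^sup>2"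
      using c by (intro add_mono mult_left_mono power_mono) (auto simp: abs_square_le_1)
    also have "\<dots> \<le> (\<eta> + (pi/2 - t))\<^sup>2" using assms t by (simp add: power2_sum)
    finally have "modulus ?m t \<le> \<eta> + (pi/2 - t)" using assms t by (auto intro: power2_le_imp_le)
    then show "1 / (\<eta> + pi/2 - t) \<le> 1 / modulus ?m t"
      using modulus_pos[OF m, of t] by (intro divide_left_mono mult_pos_pos) auto
  qed
qed

lemma elliptic_gap_zero: "\<exists>m. 0 < m \<and> m < 1 \<and> ellipticK m = 2 * ellipticE m"
proof -
  \<comment> \<open>Chosen so that ln (pi/2) - ln \<eta> = 4. Then K at 1 - \<eta>^2 is at least 4,
    which exceeds pi, an upper bound of 2E.\<close>
  define \<eta> :: real where "\<eta> = (pi/2) / exp 4"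
  have e: "exp 4 \<ge> (5::real)" using exp_ge_add_one_self[of "4::real"] by simp
  have \<eta>: "0 < \<eta>" "\<eta> < 1/2" unfolding \<eta>_def using e pi_less_4 by (auto simp: field_simps)
  \<comment> \<open>At m = 1/2 the squared modulus is at least 1/2, so the integrand is nowhere
    positive.\<close>
  have lo: "ellipticK (1/2) - 2 * ellipticE (1/2) \<le> 0"
  proof (rule has_integral_le[OF elliptic_gap_has_integral])
    show "((\<lambda>t::real. 0::real) has_integral 0) {0..pi/2}" by simp
    fix t :: real
    have "(modulus (1/2) t)\<^sup>2 \<ge> 1/2" unfolding modulus_sq[of "1/2" t, simplified] by (simp add: abs_square_le_1)
    then show "1 / modulus (1/2) t - 2 * modulus (1/2) t \<le> 0"
      using modulus_pos[of "1/2" t] by (simp add: field_simps power2_eq_square)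
  qed auto
  have \<eta>4: "\<eta>\<^sup>2 \<le> 1/4" using \<eta> power_mono[of \<eta> "1/2" 2] by (simp add: power2_eq_square)
  have "ln (pi/2) \<le> ln (\<eta> + pi/2)" using \<eta> pi_gt_zero by (intro ln_mono) linarith+
  moreover have "ln \<eta> = ln (pi/2) - 4" unfolding \<eta>_def by (subst ln_div) auto
  ultimately have "ellipticK (1 - \<eta>\<^sup>2) \<ge> 4" using ellipticK_ge[of \<eta>] \<eta> by simp
  moreover have "ellipticE (1 - \<eta>\<^sup>2) \<le> pi/2" using \<eta>4 by (intro ellipticE_le) simp
  ultimately have hi: "ellipticK (1 - \<eta>\<^sup>2) - 2 * ellipticE (1 - \<eta>\<^sup>2) \<ge> 0" using pi_less_4 by simp
  have \<eta>p: "\<eta>\<^sup>2 > 0" using \<eta> by simp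
  have "\<exists>m\<ge>1/2. m \<le> 1 - \<eta>\<^sup>2 \<and> ellipticK m - 2 * ellipticE m = 0"
  proof (rule IVT'[where f="\<lambda>m. ellipticK m - 2 * ellipticE m", OF lo hi])
    show "1/2 \<le> 1 - \<eta>\<^sup>2" using \<eta>4 by linarith
    have "{1/2..1 - \<eta>\<^sup>2} \<subseteq> {0<..<1}"
    proof
      fix x assume "x \<in> {1/2..1 - \<eta>\<^sup>2}"
      then have "1/2 \<le> x" "x \<le> 1 - \<eta>\<^sup>2" by auto
      then have "0 < x" "x < 1" using \<eta>p by linarith+
      then show "x \<in> {0<..<1}" by simp
    qed
    then show "continuous_on {1/2..1 - \<eta>\<^sup>2} (\<lambda>m. ellipticK m - 2 * ellipticE m)"
      by (rule continuous_on_subset[OF continuous_on_elliptic_gap])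
  qed
  then obtain m where m: "m \<ge> 1/2" "m \<le> 1 - \<eta>\<^sup>2" "ellipticK m = 2 * ellipticE m" by auto
  then have "0 < m" "m < 1" using \<eta>p by linarith+
  with m(3) show ?thesis by blast
qed

lemma m_star: "0 < m_star" "m_star < 1" "ellipticK m_star = 2 * ellipticE m_star"
proof -
  have "\<exists>!m. 0 < m \<and> m < 1 \<and> ellipticK m = 2 * ellipticE m"
  proof (rule ex_ex1I[OF elliptic_gap_zero])
    fix m m' :: real
    assume "0 < m \<and> m < 1 \<and> ellipticK m = 2 * ellipticE m" "0 < m' \<and> m' < 1 \<and> ellipticK m' = 2 * ellipticE m'"
    then show "m = m'" using elliptic_gap_strict_mono[of m m'] elliptic_gap_strict_mono[of m' m]
      by (cases m m' rule: linorder_cases) simp_all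
  qed
  from theI'[OF this] show "0 < m_star" "m_star < 1" "ellipticK m_star = 2 * ellipticE m_star"
    unfolding m_star_def by auto
qed

section \<open>Positivity of K and the Jacobi amplitude\<close>

lemma ellipticK_pos: assumes "0 < m" "m < 1" shows "ellipticK m > 0"
proof -
  have "((\<lambda>t::real. 1::real) has_integral pi/2) {0..pi/2}" using has_integral_const_real[of "1::real" 0 "pi/2"] by simp
  moreover have "1 \<le> 1 / modulus m t" for t
    using modulus_le_1[OF assms(1), of t] modulus_pos[OF assms, of t] by simp
  ultimately have "pi/2 \<le> ellipticK m"
    using has_integral_le[OF _ ellipticK_has_integral[OF assms]] by blast
  then show ?thesis using pi_gt_zero by linarith
qed

text \<open>Jacobi's amplitude, the inverse of the incomplete integral of the first kind. It makes
  the comparison pendulum explicit, and the last property keeps its angle where the sine is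
  positive.\<close>

lemma elliptic_amplitude:
  assumes m: "0 < m" "m < 1"
  obtains am where "am (ellipticK m) = pi/2"
    and "\<And>s. 0 \<le> s \<Longrightarrow> s \<le> ellipticK m \<Longrightarrow> (am has_real_derivative modulus m (am s)) (at s)"
    and "\<And>s. 0 < s \<Longrightarrow> s \<le> ellipticK m \<Longrightarrow> 0 < am s \<and> am s \<le> pi/2"
proof -
  let ?g = "\<lambda>t. 1 / modulus m t"
  have pos: "modulus m t > 0" for t using modulus_pos m by blast
  have cg: "continuous_on S ?g" for S
    by (intro continuous_intros ballI modulus_nonzero m)
  \<comment> \<open>Starting the integral at -1 and continuing beyond pi/2 puts [0, pi/2] in the
    interior of the domain, so the inverse has two-sided derivatives at 0 and K as well. The shift
    makes F 0 = 0.\<close>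
  define F where "F y = integral {-1..y} ?g - integral {-1..0} ?g" for y
  have dF: "(F has_real_derivative ?g y) (at y)" if "-1 < y" "y < 3" for y
  proof -
    have "((\<lambda>y. integral {-1..y} ?g) has_real_derivative ?g y) (at y within {-1..3})"
      using that by (intro integral_has_real_derivative cg) auto
    moreover have "at y within {-1..3} = at y" using that by (intro at_within_Icc_at) auto
    ultimately show ?thesis unfolding F_def by (auto intro!: derivative_eq_intros)
  qed
  have Fmono: "F x < F y" if "-1 < x" "x < y" "y < 3" for x y
  proof (rule DERIV_pos_imp_increasing[OF that(2)])
    fix z assume "x \<le> z" "z \<le> y"
    then show "\<exists>d. DERIV F z :> d \<and> 0 < d" using dF[of z] that pos[of z] by (intro exI[of _ "?g z"]) auto
  qed
  have F0: "F 0 = 0" by (simp add: F_def)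
  have pih: "pi/2 < 2" "0 < pi/2" using pi_less_4 by auto
  have FK: "F (pi/2) = ellipticK m"
  proof -
    have "integral {-1..0} ?g + integral {0..pi/2} ?g = integral {-1..pi/2} ?g"
      using cg pih by (intro Henstock_Kurzweil_Integration.integral_combine integrable_continuous_real) auto
    then show ?thesis using ellipticK_has_integral[OF m] by (simp add: F_def integral_unique)
  qed
  define am where "am s = (THE y. -1/2 \<le> y \<and> y \<le> 2 \<and> F y = s)" for s
  have amF: "am (F y) = y" if "-1/2 \<le> y" "y \<le> 2" for y
    unfolding am_def
  proof (rule the_equality)
    fix z assume "-1/2 \<le> z \<and> z \<le> 2 \<and> F z = F y"
    then show "z = y" using Fmono[of z y] Fmono[of y z] that by (cases z y rule: linorder_cases) auto
  qed (use that in auto)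
  have Fsurj: "\<exists>y. -1/2 \<le> y \<and> y \<le> 2 \<and> F y = s" if "F (-1/2) \<le> s" "s \<le> F 2" for s
  proof -
    have "isCont F x" if "x \<in> {-1/2..2}" for x
      using dF[of x] that by (intro DERIV_isCont) auto
    then have "continuous_on {-1/2..2} F" by (intro continuous_at_imp_continuous_on) auto
    with IVT'[of F "-1/2" s 2] that show ?thesis by auto
  qed
  have Fam: "F (am s) = s" if "F (-1/2) \<le> s" "s \<le> F 2" for s
  proof -
    from Fsurj[OF that] obtain y where "-1/2 \<le> y" "y \<le> 2" "F y = s" by blast
    then show ?thesis using amF[of y] by simp
  qed
  show thesis
  proof
    show "am (ellipticK m) = pi/2" using amF[of "pi/2"] FK pih by simp
    fix s assume s: "0 \<le> s" "s \<le> ellipticK m"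
    have "F (-1/2) < s" using Fmono[of "-1/2" 0] F0 s by simp
    moreover have "s < F 2" using Fmono[of "pi/2" 2] pih FK s by simp
    ultimately obtain y where y: "-1/2 \<le> y" "y \<le> 2" "F y = s" using Fsurj[of s] by auto
    have y': "-1/2 < y" "y < 2" using y \<open>F (-1/2) < s\<close> \<open>s < F 2\<close> by (auto simp: less_le)
    have y0: "0 \<le> y \<and> y \<le> pi/2"
    proof (rule conjI; rule ccontr)
      assume "\<not> 0 \<le> y" then show False using Fmono[of y 0] y y' F0 s by auto
    next
      assume "\<not> y \<le> pi/2" then show False using Fmono[of "pi/2" y] y y' FK s pih by auto
    qed
    have ams: "am s = y" using amF y by auto
    have "isCont am (F y)"
    proof (rule isCont_inverse_function2[where a="-1/2" and x=y and b=2 and f=F and g=am])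
      show "isCont F z" if "-1/2 \<le> z" "z \<le> 2" for z using dF[of z] that by (intro DERIV_isCont) auto
    qed (use y' amF in simp_all)
    then have "isCont am s" using y by simp
    have "DERIV am s :> inverse (?g (am s))"
    proof (rule DERIV_inverse_function[where f=F and g=am and x=s and a="F (-1/2)" and b="F 2"])
      show "DERIV F (am s) :> ?g (am s)" using dF ams y' by auto
      show "?g (am s) \<noteq> 0" using pos[of "am s"] by simp
    qed (use \<open>F (-1/2) < s\<close> \<open>s < F 2\<close> Fam \<open>isCont am s\<close> in \<open>simp_all\<close>)
    then show "(am has_real_derivative modulus m (am s)) (at s)" by simp
  next
    fix s assume s: "0 < s" "s \<le> ellipticK m"
    have "F (-1/2) < s" using Fmono[of "-1/2" 0] F0 s by simp
    moreover have "s < F 2" using Fmono[of "pi/2" 2] pih FK s by simp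
    ultimately obtain y where y: "-1/2 \<le> y" "y \<le> 2" "F y = s" using Fsurj[of s] by auto
    have "0 < y \<and> y \<le> pi/2"
    proof (rule conjI; rule ccontr)
      assume "\<not> 0 < y" then show False using Fmono[of y 0] y F0 s by (cases "y = 0") auto
    next
      assume "\<not> y \<le> pi/2"
      then show False using Fmono[of "pi/2" y] y FK s pih by auto
    qed
    then show "0 < am s \<and> am s \<le> pi/2" using amF y by auto
  qed
qed

section \<open>The calibrated bound for a loop\<close>

text \<open>\<open>w\<close> is the parameter derivative of T, \<open>v\<close> the speed, and c = T
  \<bullet> e. Expanding the square of w - q v u, with u the part of e orthogonal to T, gives
  Young's inequality for c'^2 / (1 - c^2) without dividing by 1 - c^2. Dropping (c - c0)^2 leaves an
  expression affine in c. The \<omega>^2 terms cancel; they are inserted so that the first bracket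
  becomes the derivative of q (c - 1) along the pendulum.\<close>

lemma calibration_pointwise:
  fixes w T e :: "'a::real_inner" and v q c0 \<omega> :: real
  assumes "norm T = 1" "norm e = 1" "T \<bullet> w = 0" "v > 0"
  shows "2 * (q * (w \<bullet> e) + v * (\<omega>\<^sup>2 + q\<^sup>2 * c0) * (T \<bullet> e - 1))
      + v * (2 * \<omega>\<^sup>2 - 2 * \<omega>\<^sup>2 * (T \<bullet> e) - q\<^sup>2 * (1 - c0)\<^sup>2) \<le> (norm w)\<^sup>2 / v"
proof -
  let ?C = "T \<bullet> e"
  have TT: "T \<bullet> T = 1" "e \<bullet> e = 1" using assms by (simp_all add: norm_eq_1)
  define u where "u = e - ?C *\<^sub>R T"
  have wu: "w \<bullet> u = w \<bullet> e" using assms(3) by (simp add: u_def inner_diff_right inner_commute)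
  have uu: "u \<bullet> u = 1 - ?C\<^sup>2"
    using TT by (simp add: u_def inner_diff_left inner_diff_right inner_commute power2_eq_square)
  have "0 \<le> (norm (w - (q * v) *\<^sub>R u))\<^sup>2" by simp
  also have "\<dots> = (norm w)\<^sup>2 - 2 * (q * v) * (w \<bullet> u) + (q * v)\<^sup>2 * (u \<bullet> u)"
    unfolding power2_norm_eq_inner
    by (simp add: inner_diff_left inner_diff_right inner_commute power2_eq_square algebra_simps)
  also have "\<dots> = (norm w)\<^sup>2 - 2 * (q * v) * (w \<bullet> e) + (q * v)\<^sup>2 * (1 - ?C\<^sup>2)"
    unfolding wu uu ..
  finally have "2 * q * (w \<bullet> e) * v - q\<^sup>2 * v\<^sup>2 * (1 - ?C\<^sup>2) \<le> (norm w)\<^sup>2"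
    by (simp add: algebra_simps power_mult_distrib)
  then have "2 * q * (w \<bullet> e) - v * q\<^sup>2 * (1 - ?C\<^sup>2) \<le> (norm w)\<^sup>2 / v"
    using assms(4) by (simp add: field_simps power2_eq_square)
  moreover have "0 \<le> v * q\<^sup>2 * (?C - c0)\<^sup>2" using assms(4) by simp
  moreover have "2 * (q * (w \<bullet> e) + v * (\<omega>\<^sup>2 + q\<^sup>2 * c0) * (?C - 1))
      + v * (2 * \<omega>\<^sup>2 - 2 * \<omega>\<^sup>2 * ?C - q\<^sup>2 * (1 - c0)\<^sup>2) =
      2 * q * (w \<bullet> e) - v * q\<^sup>2 * (1 - ?C\<^sup>2) - v * q\<^sup>2 * (?C - c0)\<^sup>2"
    by (simp add: algebra_simps power2_eq_square)
  ultimately show ?thesis by linarith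
qed

text \<open>
  The comparison pendulum has angle \<open>\<theta>\<close> with \<open>sin (\<theta>/2) = sqrt m * sin \<Psi>\<close>, so \<open>c0 = cos \<theta> = 1 - 2 m sin\<^sup>2 \<Psi>\<close>,
  and \<open>q = c0' / (1 - c0\<^sup>2)\<close> with the arclength derivative; the identity below is its Euler-Lagrange equation.
\<close>

lemma DERIV_calibration_field:
  assumes m: "0 < m" "m < 1" and s: "sin (\<Psi> x) > 0"
    and \<Psi>: "(\<Psi> has_real_derivative \<omega> * v * modulus m (\<Psi> x)) (at x within S)"
  defines "q \<equiv> \<lambda>x. - \<omega> * cos (\<Psi> x) / (sin (\<Psi> x) * modulus m (\<Psi> x))"
  shows "(q has_real_derivative v * (\<omega>\<^sup>2 + (q x)\<^sup>2 * (1 - 2 * m * (sin (\<Psi> x))\<^sup>2))) (at x within S)"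
proof -
  have D: "modulus m (\<Psi> x) > 0" using modulus_pos[OF m] .
  define s c D where "s = sin (\<Psi> x)" and "c = cos (\<Psi> x)" and "D = modulus m (\<Psi> x)"
  have sc: "s\<^sup>2 + c\<^sup>2 = 1" by (simp add: s_def c_def)
  have DD: "D\<^sup>2 = 1 - m * s\<^sup>2" unfolding D_def s_def by (rule modulus_sq[OF m])
  have p: "s > 0" "D > 0" using \<open>sin (\<Psi> x) > 0\<close> D by (simp_all add: s_def D_def)
  have "(q has_real_derivative
     ((- \<omega> * (- s * (\<omega> * v * D))) * (s * D) - (- \<omega> * c) * (c * (\<omega> * v * D) * D + s * (- m * s * c / D * (\<omega> * v * D)))) / ((s * D) * (s * D)))
     (at x within S)"
    unfolding q_def s_def c_def D_def using s D
    by (auto intro!: derivative_eq_intros m \<Psi> simp: field_simps)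
  moreover have "((- \<omega> * (- s * (\<omega> * v * D))) * (s * D) - (- \<omega> * c) * (c * (\<omega> * v * D) * D + s * (- m * s * c / D * (\<omega> * v * D)))) / ((s * D) * (s * D))
     = v * (\<omega>\<^sup>2 + (- \<omega> * c / (s * D))\<^sup>2 * (1 - 2 * m * s\<^sup>2))" (is "?l / ?d = ?r")
  proof -
    have "?l = \<omega>\<^sup>2 * v * (s\<^sup>2 * D\<^sup>2 + c\<^sup>2 * D\<^sup>2 - m * s\<^sup>2 * c\<^sup>2)"
      using p by (simp add: field_simps power2_eq_square)
    also have "s\<^sup>2 * D\<^sup>2 + c\<^sup>2 * D\<^sup>2 - m * s\<^sup>2 * c\<^sup>2 = s\<^sup>2 * D\<^sup>2 + c\<^sup>2 * (1 - 2 * m * s\<^sup>2)"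
      unfolding DD by (simp add: algebra_simps)
    finally have l: "?l = \<omega>\<^sup>2 * v * (s\<^sup>2 * D\<^sup>2 + c\<^sup>2 * (1 - 2 * m * s\<^sup>2))" .
    have "?d * ?r = \<omega>\<^sup>2 * v * (s\<^sup>2 * D\<^sup>2 + c\<^sup>2 * (1 - 2 * m * s\<^sup>2))"
      using p by (simp add: field_simps power2_eq_square)
    then have "?l = ?d * ?r" using l by (simp only:)
    moreover have "?d \<noteq> 0" using p by simp
    ultimately show ?thesis by (metis nonzero_mult_div_cancel_left)
  qed
  ultimately show ?thesis by (simp add: q_def s_def c_def D_def)
qed

text \<open>In the application a is the midpoint of the loop and b its end. The integral of c is
  left unestimated, to cancel against that of the other half. The strict bound on \<omega> says that
  the pendulum is slower than the one that starts at amplitude 0.\<close>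

lemma calibration_half:
  fixes T w :: "real \<Rightarrow> 'a::euclidean_space"
  assumes ab: "a \<le> b" and prim: "primitive_on T w a b"
    and T1: "\<And>x. x \<in> {a..b} \<Longrightarrow> norm (T x) = 1"
    and perp: "\<And>x. x \<in> {a..b} \<Longrightarrow> T x \<bullet> w x = 0"
    and cv: "continuous_on {a..b} v" and v: "\<And>x. x \<in> {a..b} \<Longrightarrow> v x > 0"
    and en: "(\<lambda>x. (norm (w x))\<^sup>2 / v x) integrable_on {a..b}"
    and m: "0 < m" "m < 1" and \<omega>: "0 < \<omega>" "\<omega> * integral {a..b} v < ellipticK m"
  shows "2 * \<omega>\<^sup>2 * integral {a..b} v - 2 * \<omega>\<^sup>2 * integral {a..b} (\<lambda>x. v x * (T x \<bullet> T a))
      - 4 * \<omega> * ((2 - m) * ellipticK m - 2 * ellipticE m)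
    \<le> integral {a..b} (\<lambda>x. (norm (w x))\<^sup>2 / v x)"
proof -
  obtain am where am: "am (ellipticK m) = pi/2"
      "\<And>s. 0 \<le> s \<Longrightarrow> s \<le> ellipticK m \<Longrightarrow> (am has_real_derivative modulus m (am s)) (at s)"
      "\<And>s. 0 < s \<Longrightarrow> s \<le> ellipticK m \<Longrightarrow> 0 < am s \<and> am s \<le> pi/2"
    using elliptic_amplitude[OF m] by metis
  let ?K = "ellipticK m" and ?A = "integral {a..b} v" and ?J = "(2 - m) * ellipticK m - 2 * ellipticE m"
  have iv: "v integrable_on {x..y}" if "a \<le> x" "y \<le> b" for x y
    using that by (intro integrable_continuous_real continuous_on_subset[OF cv]) auto
  define \<sigma> where "\<sigma> x = integral {a..x} v" for x
  have d\<sigma>: "(\<sigma> has_real_derivative v x) (at x within {a..b})" if "x \<in> {a..b}" for x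
    unfolding \<sigma>_def by (rule integral_has_real_derivative[OF cv that])
  have \<sigma>: "0 \<le> \<sigma> x" "\<sigma> x \<le> ?A" if x: "x \<in> {a..b}" for x
  proof -
    show "0 \<le> \<sigma> x" unfolding \<sigma>_def using x v by (intro Henstock_Kurzweil_Integration.integral_nonneg iv) (auto intro: less_imp_le)
    have "0 \<le> integral {x..b} v" using x v by (intro Henstock_Kurzweil_Integration.integral_nonneg iv) (auto intro: less_imp_le)
    moreover have "\<sigma> x + integral {x..b} v = ?A" unfolding \<sigma>_def
      using x by (intro Henstock_Kurzweil_Integration.integral_combine iv) auto
    ultimately show "\<sigma> x \<le> ?A" by simp
  qed
  \<comment> \<open>The phase reaches K, hence amplitude pi/2, exactly at b, so q b = 0. At a it is
    K - \<omega> A > 0, so sin \<Psi> stays positive and q finite.\<close>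
  define z where "z x = ?K - \<omega> * (?A - \<sigma> x)" for x
  have z: "0 < z x" "z x \<le> ?K" if "x \<in> {a..b}" for x
  proof -
    have "\<omega> * (?A - \<sigma> x) \<le> \<omega> * ?A" "0 \<le> \<omega> * (?A - \<sigma> x)" using \<omega>(1) \<sigma>[OF that] by auto
    then show "0 < z x" "z x \<le> ?K" unfolding z_def using \<omega>(2) by linarith+
  qed
  define \<Psi> where "\<Psi> x = am (z x)" for x
  have \<Psi>: "0 < \<Psi> x" "\<Psi> x \<le> pi/2" if "x \<in> {a..b}" for x
    unfolding \<Psi>_def using am(3)[OF z[OF that]] by auto
  have \<Psi>b: "\<Psi> b = pi/2" using am(1) by (simp add: \<Psi>_def z_def \<sigma>_def)
  have dz: "(z has_real_derivative \<omega> * v x) (at x within {a..b})" if "x \<in> {a..b}" for x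
    unfolding z_def by (auto intro!: derivative_eq_intros d\<sigma>[OF that])
  have d\<Psi>: "(\<Psi> has_real_derivative \<omega> * v x * modulus m (\<Psi> x)) (at x within {a..b})" if "x \<in> {a..b}" for x
  proof -
    have \<Psi>_eq: "\<Psi> = (\<lambda>x. am (z x))" by (simp add: \<Psi>_def fun_eq_iff)
    show ?thesis unfolding \<Psi>_eq
      using DERIV_chain2[OF am(2) dz[OF that]] z[OF that] by (simp add: mult.commute)
  qed
  have s: "sin (\<Psi> x) > 0" if "x \<in> {a..b}" for x
    using \<Psi>[OF that] pi_gt_zero by (intro sin_gt_zero) linarith+
  have c\<Psi>: "continuous_on {a..b} \<Psi>" using d\<Psi> by (rule DERIV_continuous_on)
  define q where "q x = - \<omega> * cos (\<Psi> x) / (sin (\<Psi> x) * modulus m (\<Psi> x))" for x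
  define c0 where "c0 x = 1 - 2 * m * (sin (\<Psi> x))\<^sup>2" for x
  have dq: "(q has_real_derivative v x * (\<omega>\<^sup>2 + (q x)\<^sup>2 * c0 x)) (at x within {a..b})" if "x \<in> {a..b}" for x
    unfolding q_def c0_def by (rule DERIV_calibration_field[OF m s[OF that] d\<Psi>[OF that]])
  have cq: "continuous_on {a..b} q" using dq by (rule DERIV_continuous_on)
  have cc0: "continuous_on {a..b} c0" unfolding c0_def by (intro continuous_intros c\<Psi>)
  define C where "C x = T x \<bullet> T a" for x
  have pC: "primitive_on (\<lambda>x. C x - 1) (\<lambda>x. w x \<bullet> T a) a b"
    using primitive_on_inner[OF prim, of "T a"] by (simp add: primitive_on_def C_def)
  have cC: "continuous_on {a..b} C" unfolding C_def
    by (intro continuous_intros primitive_on_continuous[OF prim])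
  \<comment> \<open>By the product rule and the equation for q, this is the density of q (C - 1).
    The boundary terms vanish since C = 1 at a and q = 0 at b.\<close>
  define S where "S x = q x * (w x \<bullet> T a) + v x * (\<omega>\<^sup>2 + (q x)\<^sup>2 * c0 x) * (C x - 1)" for x
  have "primitive_on (\<lambda>x. q x *\<^sub>R (C x - 1)) (\<lambda>x. q x *\<^sub>R (w x \<bullet> T a) + (v x * (\<omega>\<^sup>2 + (q x)\<^sup>2 * c0 x)) *\<^sub>R (C x - 1)) a b"
    by (intro primitive_on_scaleR dq pC continuous_intros cv cq cc0)
  then have "(S has_integral q b * (C b - 1) - q a * (C a - 1)) {a..b}"
    using primitive_on_has_integral[of _ _ a b a b] ab unfolding S_def by fastforce
  moreover have "q b = 0" by (simp add: q_def \<Psi>b)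
  moreover have "C a = 1" using T1[of a] ab by (simp add: C_def norm_eq_1)
  ultimately have S0: "(S has_integral 0) {a..b}" by simp
  \<comment> \<open>The substitution t = \<Psi> x, dt = \<omega> v modulus dx turns v r dx into 4
    \<omega> \<rho>(t) dt, so the error term only depends on the range of amplitudes
    covered.\<close>
  define \<rho> where "\<rho> t = m\<^sup>2 * (sin t)\<^sup>2 * (cos t)\<^sup>2 / (modulus m t)^3" for t
  have c\<rho>: "continuous_on X \<rho>" for X unfolding \<rho>_def using modulus_nonzero[OF m]
    by (intro continuous_intros) auto
  have \<rho>0: "\<rho> t \<ge> 0" for t using modulus_pos[OF m, of t] by (simp add: \<rho>_def)
  define R where "R y = integral {0..y} \<rho>" for y
  have RJ: "R (pi/2) = ?J" unfolding R_def \<rho>_def using elliptic_J_has_integral[OF m] by (rule integral_unique)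
  have dR: "(R has_real_derivative \<rho> y) (at y within {0..pi/2})" if "y \<in> {0..pi/2}" for y
    unfolding R_def by (rule integral_has_real_derivative[OF c\<rho> that])
  define r where "r x = (q x)\<^sup>2 * (1 - c0 x)\<^sup>2" for x
  have "((\<lambda>x. v x * r x) has_integral 4 * \<omega> * R (\<Psi> b) - 4 * \<omega> * R (\<Psi> a)) {a..b}"
  proof (rule fundamental_theorem_of_calculus[OF ab])
    fix x assume x: "x \<in> {a..b}"
    \<comment> \<open>\<open>R\<close> is differentiated within [0, pi/2] only and \<Psi> b = pi/2
      is an endpoint, hence the restriction to the image of \<Psi>.\<close>
    have "\<Psi> ` {a..b} \<subseteq> {0..pi/2}" using \<Psi> by (force intro: less_imp_le)
    then have "(R has_real_derivative \<rho> (\<Psi> x)) (at (\<Psi> x) within \<Psi> ` {a..b})"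
      using \<Psi>[OF x] by (intro has_field_derivative_subset[OF dR]) auto
    from DERIV_image_chain[OF this d\<Psi>[OF x]]
    have "((\<lambda>x. R (\<Psi> x)) has_real_derivative \<rho> (\<Psi> x) * (\<omega> * v x * modulus m (\<Psi> x))) (at x within {a..b})" by (simp add: o_def)
    then have "((\<lambda>x. 4 * \<omega> * R (\<Psi> x)) has_real_derivative 4 * \<omega> * (\<rho> (\<Psi> x) * (\<omega> * v x * modulus m (\<Psi> x)))) (at x within {a..b})"
      by (rule DERIV_cmult)
    moreover have "4 * \<omega> * (\<rho> (\<Psi> x) * (\<omega> * v x * modulus m (\<Psi> x))) = v x * r x"
      unfolding \<rho>_def r_def q_def c0_def using s[OF x] modulus_pos[OF m, of "\<Psi> x"]
      by (simp add: field_simps power2_eq_square power3_eq_cube)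
    ultimately show "((\<lambda>x. 4 * \<omega> * R (\<Psi> x)) has_vector_derivative v x * r x) (at x within {a..b})"
      by (simp add: has_real_derivative_iff_has_vector_derivative)
  qed
  then have r: "((\<lambda>x. v x * r x) has_integral 4 * \<omega> * ?J - 4 * \<omega> * R (\<Psi> a)) {a..b}"
    by (simp add: \<Psi>b RJ)
  \<comment> \<open>The amplitudes below \<Psi> a, which the slower pendulum does not cover,
    contribute with a favourable sign and are dropped at the end.\<close>
  have Ra: "R (\<Psi> a) \<ge> 0" unfolding R_def
    by (intro Henstock_Kurzweil_Integration.integral_nonneg integrable_continuous_real c\<rho> \<rho>0)
  have vC: "(\<lambda>x. v x * C x) integrable_on {a..b}"
    by (intro integrable_continuous_real continuous_intros cv cC)
  have "((\<lambda>x. 2 * S x + (2 * \<omega>\<^sup>2 * v x - 2 * \<omega>\<^sup>2 * (v x * C x)) - v x * r x) has_integral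
     2 * 0 + (2 * \<omega>\<^sup>2 * ?A - 2 * \<omega>\<^sup>2 * integral {a..b} (\<lambda>x. v x * C x)) - (4 * \<omega> * ?J - 4 * \<omega> * R (\<Psi> a))) {a..b}"
    by (intro has_integral_add has_integral_diff has_integral_mult_right S0 r integrable_integral iv vC) auto
  then have "2 * 0 + (2 * \<omega>\<^sup>2 * ?A - 2 * \<omega>\<^sup>2 * integral {a..b} (\<lambda>x. v x * C x)) - (4 * \<omega> * ?J - 4 * \<omega> * R (\<Psi> a))
     \<le> integral {a..b} (\<lambda>x. (norm (w x))\<^sup>2 / v x)"
  proof (rule has_integral_le[OF _ integrable_integral[OF en]])
    fix x assume x: "x \<in> {a..b}"
    have "2 * S x + (2 * \<omega>\<^sup>2 * v x - 2 * \<omega>\<^sup>2 * (v x * C x)) - v x * r x =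
      2 * (q x * (w x \<bullet> T a) + v x * (\<omega>\<^sup>2 + (q x)\<^sup>2 * c0 x) * (T x \<bullet> T a - 1))
      + v x * (2 * \<omega>\<^sup>2 - 2 * \<omega>\<^sup>2 * (T x \<bullet> T a) - (q x)\<^sup>2 * (1 - c0 x)\<^sup>2)"
      by (simp add: S_def r_def C_def algebra_simps)
    also have "\<dots> \<le> (norm (w x))\<^sup>2 / v x"
      using x ab by (intro calibration_pointwise T1 perp v) auto
    finally show "2 * S x + (2 * \<omega>\<^sup>2 * v x - 2 * \<omega>\<^sup>2 * (v x * C x)) - v x * r x \<le> (norm (w x))\<^sup>2 / v x" .
  qed
  moreover have "0 \<le> 4 * \<omega> * R (\<Psi> a)" using Ra \<omega> by simp
  ultimately show ?thesis unfolding C_def by linarith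
qed

section \<open>From the two halves to the whole loop\<close>

lemma primitive_on_reflect:
  assumes "primitive_on F f a b"
  shows "primitive_on (\<lambda>x. F (- x)) (\<lambda>x. - f (- x)) (- b) (- a)"
  unfolding primitive_on_def
proof (intro conjI allI impI)
  have "(\<lambda>x. f (- x)) absolutely_integrable_on {- b..- a}"
    using primitive_on_absint[OF assms] by simp
  from absolutely_integrable_linear[OF this bounded_linear_minus[OF bounded_linear_ident]]
  show "(\<lambda>x. - f (- x)) absolutely_integrable_on {- b..- a}" by (simp add: o_def)
  fix x y assume "- b \<le> x" "x \<le> y" "y \<le> - a"
  then have "(f has_integral (F (- x) - F (- y))) {- y..- x}"
    by (intro primitive_on_has_integral[OF assms]) auto
  then have "((\<lambda>x. f (- x)) has_integral (F (- x) - F (- y))) {x..y}"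
    using has_integral_reflect_real[of f "F (- x) - F (- y)" "- x" "- y"] by simp
  from has_integral_neg[OF this]
  show "((\<lambda>x. - f (- x)) has_integral F (- y) - F (- x)) {x..y}" by simp
qed

text \<open>Reversing the parameter changes the sign of \<open>w\<close>, which affects neither its
  norm nor its orthogonality to T. The reference direction becomes the tangent at the right
  endpoint.\<close>

lemma calibration_half_left:
  fixes T w :: "real \<Rightarrow> 'a::euclidean_space"
  assumes ab: "a \<le> b" and prim: "primitive_on T w a b"
    and T1: "\<And>x. x \<in> {a..b} \<Longrightarrow> norm (T x) = 1"
    and perp: "\<And>x. x \<in> {a..b} \<Longrightarrow> T x \<bullet> w x = 0"
    and cv: "continuous_on {a..b} v" and v: "\<And>x. x \<in> {a..b} \<Longrightarrow> v x > 0"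
    and en: "(\<lambda>x. (norm (w x))\<^sup>2 / v x) integrable_on {a..b}"
    and m: "0 < m" "m < 1" and \<omega>: "0 < \<omega>" "\<omega> * integral {a..b} v < ellipticK m"
  shows "2 * \<omega>\<^sup>2 * integral {a..b} v - 2 * \<omega>\<^sup>2 * integral {a..b} (\<lambda>x. v x * (T x \<bullet> T b))
      - 4 * \<omega> * ((2 - m) * ellipticK m - 2 * ellipticE m)
    \<le> integral {a..b} (\<lambda>x. (norm (w x))\<^sup>2 / v x)"
proof -
  have refl: "integral {- b..- a} (\<lambda>x. f (- x)) = integral {a..b} f" for f :: "real \<Rightarrow> real"
    using Henstock_Kurzweil_Integration.integral_reflect_real[of b a f] by simp
  have "2 * \<omega>\<^sup>2 * integral {- b..- a} (\<lambda>x. v (- x)) - 2 * \<omega>\<^sup>2 * integral {- b..- a} (\<lambda>x. v (- x) * (T (- x) \<bullet> T (- (- b))))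
      - 4 * \<omega> * ((2 - m) * ellipticK m - 2 * ellipticE m)
    \<le> integral {- b..- a} (\<lambda>x. (norm (- w (- x)))\<^sup>2 / v (- x))"
  proof (rule calibration_half[OF _ primitive_on_reflect[OF prim] _ _ _ _ _ m \<omega>(1)])
    show "continuous_on {- b..- a} (\<lambda>x. v (- x))"
      by (rule continuous_on_compose2[OF cv]) (auto intro!: continuous_intros)
    show "(\<lambda>x. (norm (- w (- x)))\<^sup>2 / v (- x)) integrable_on {- b..- a}"
      using en Henstock_Kurzweil_Integration.integrable_reflect_real[where f="\<lambda>x. (norm (w x))\<^sup>2 / v x" and b=b and a=a] by simp
    show "\<omega> * integral {- b..- a} (\<lambda>x. v (- x)) < ellipticK m" unfolding refl by (rule \<omega>(2))
  qed (use ab T1 perp v in auto)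
  then show ?thesis
    using refl[of v] refl[of "\<lambda>x. v x * (T x \<bullet> T b)"] refl[of "\<lambda>x. (norm (w x))\<^sup>2 / v x"] by simp
qed

text \<open>Splitting at the arclength midpoint \<mu> gives both halves the same length, so one
  \<omega> serves both, and both take T \<mu> as reference direction.\<close>

lemma loop_bending_bound:
  fixes T w :: "real \<Rightarrow> 'a::euclidean_space"
  assumes ab: "a < b" and prim: "primitive_on T w a b"
    and T1: "\<And>x. x \<in> {a..b} \<Longrightarrow> norm (T x) = 1"
    and perp: "\<And>x. x \<in> {a..b} \<Longrightarrow> T x \<bullet> w x = 0"
    and cv: "continuous_on {a..b} v" and v: "\<And>x. x \<in> {a..b} \<Longrightarrow> v x > 0"
    and en: "(\<lambda>x. (norm (w x))\<^sup>2 / v x) integrable_on {a..b}"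
    and closed: "((\<lambda>x. v x *\<^sub>R T x) has_integral 0) {a..b}"
  shows "integral {a..b} v > 0" "varpi_star / integral {a..b} v \<le> integral {a..b} (\<lambda>x. (norm (w x))\<^sup>2 / v x)"
proof -
  note m = m_star(1,2)
  let ?L = "integral {a..b} v" and ?K = "ellipticK m_star" and ?E = "ellipticE m_star"
  let ?J = "(2 - m_star) * ?K - 2 * ?E" and ?B = "\<lambda>x y. integral {x..y} (\<lambda>x. (norm (w x))\<^sup>2 / v x)"
  have iv: "v integrable_on {x..y}" if "a \<le> x" "y \<le> b" for x y
    using that by (intro integrable_continuous_real continuous_on_subset[OF cv]) auto
  have "integral {a..b} (\<lambda>x. 0) < ?L"
    using ab v cv by (intro integral_less_real) auto
  then show L: "?L > 0" by simp
  have "continuous_on {a..b} (\<lambda>x. integral {a..x} v)"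
    using iv by (intro indefinite_integral_continuous_1) auto
  then have "\<exists>x\<ge>a. x \<le> b \<and> integral {a..x} v = ?L / 2"
    using L ab by (intro IVT') auto
  then obtain \<mu> where \<mu>: "a \<le> \<mu>" "\<mu> \<le> b" "integral {a..\<mu>} v = ?L / 2" by blast
  have \<mu>': "integral {\<mu>..b} v = ?L / 2"
    using Henstock_Kurzweil_Integration.integral_combine[OF \<mu>(1,2) iv] \<mu>(3) by simp
  have en': "(\<lambda>x. (norm (w x))\<^sup>2 / v x) integrable_on {x..y}" if "a \<le> x" "y \<le> b" for x y
    using integrable_subinterval_real[OF en] that by auto
  have B: "?B a \<mu> + ?B \<mu> b = ?B a b"
    using \<mu> en by (intro Henstock_Kurzweil_Integration.integral_combine) auto
  \<comment> \<open>The loop condition enters here: the integrals of c over the two halves are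
    opposite, so the terms left over by the calibration cancel.\<close>
  have vT: "((\<lambda>x. v x * (T x \<bullet> T \<mu>)) has_integral 0) {a..b}"
    using has_integral_linear[OF closed bounded_linear_inner_left[of "T \<mu>"]] by (simp add: o_def)
  then have vT0: "integral {a..\<mu>} (\<lambda>x. v x * (T x \<bullet> T \<mu>)) + integral {\<mu>..b} (\<lambda>x. v x * (T x \<bullet> T \<mu>)) = 0"
    using Henstock_Kurzweil_Integration.integral_combine[OF \<mu>(1,2), of "\<lambda>x. v x * (T x \<bullet> T \<mu>)"]
    by (simp add: integral_unique has_integral_integrable)
  have pl: "primitive_on T w a \<mu>" and pr: "primitive_on T w \<mu> b"
    using primitive_on_subset[OF prim] \<mu> by simp_all
  have cl: "continuous_on {a..\<mu>} v" and cr: "continuous_on {\<mu>..b} v"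
    using \<mu> by (auto intro: continuous_on_subset[OF cv])
  have key: "2 * \<omega>\<^sup>2 * ?L - 8 * \<omega> * ?J \<le> ?B a b" if \<omega>: "0 < \<omega>" "\<omega> < 2 * ?K / ?L" for \<omega>
  proof -
    have \<omega>L: "\<omega> * (?L / 2) < ?K" using \<omega> L by (simp add: field_simps)
    have \<omega>': "\<omega> * integral {a..\<mu>} v < ?K" "\<omega> * integral {\<mu>..b} v < ?K" unfolding \<mu>(3) \<mu>' by (rule \<omega>L)+
    have "2 * \<omega>\<^sup>2 * integral {a..\<mu>} v - 2 * \<omega>\<^sup>2 * integral {a..\<mu>} (\<lambda>x. v x * (T x \<bullet> T \<mu>)) - 4 * \<omega> * ?J \<le> ?B a \<mu>"
      using calibration_half_left[OF \<mu>(1) pl T1 perp cl v en' m \<omega>(1) \<omega>'(1)] \<mu>(1,2) by simp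
    moreover have "2 * \<omega>\<^sup>2 * integral {\<mu>..b} v - 2 * \<omega>\<^sup>2 * integral {\<mu>..b} (\<lambda>x. v x * (T x \<bullet> T \<mu>)) - 4 * \<omega> * ?J \<le> ?B \<mu> b"
      using calibration_half[OF \<mu>(2) pr T1 perp cr v en' m \<omega>(1) \<omega>'(2)] \<mu>(1,2) by simp
    moreover have "2 * \<omega>\<^sup>2 * integral {a..\<mu>} (\<lambda>x. v x * (T x \<bullet> T \<mu>)) + 2 * \<omega>\<^sup>2 * integral {\<mu>..b} (\<lambda>x. v x * (T x \<bullet> T \<mu>)) = 0"
      unfolding distrib_left[symmetric] vT0 by simp
    ultimately show ?thesis using B unfolding \<mu>(3) \<mu>' by linarith
  qed
  have K: "?K > 0" using m by (rule ellipticK_pos)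
  let ?\<omega> = "2 * ?K / ?L"
  have "0 < ?\<omega>" using K L by simp
  \<comment> \<open>The value \<omega> = 2K/L is excluded in the calibration, since the pendulum
    would start at amplitude 0 where q is infinite. The inequality survives the limit from
    below.\<close>
  have "((\<lambda>\<omega>. 2 * \<omega>\<^sup>2 * ?L - 8 * \<omega> * ?J) \<longlongrightarrow> 2 * ?\<omega>\<^sup>2 * ?L - 8 * ?\<omega> * ?J) (at_left ?\<omega>)"
    by (intro tendsto_intros)
  moreover have "eventually (\<lambda>\<omega>. 2 * \<omega>\<^sup>2 * ?L - 8 * \<omega> * ?J \<le> ?B a b) (at_left ?\<omega>)"
    using eventually_at_left_real[OF \<open>0 < ?\<omega>\<close>] by eventually_elim (auto intro: key)
  ultimately have "2 * ?\<omega>\<^sup>2 * ?L - 8 * ?\<omega> * ?J \<le> ?B a b"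
    by (rule tendsto_upperbound) simp
  \<comment> \<open>With K = 2E one has J = 2 (1 - m) E, hence 8 K (K - 2 J) = 32 (2 m - 1)
    E^2.\<close>
  moreover have "2 * ?\<omega>\<^sup>2 * ?L - 8 * ?\<omega> * ?J = varpi_star / ?L"
    unfolding varpi_star_def m_star(3) using L by (simp add: field_simps power2_eq_square)
  ultimately show "varpi_star / ?L \<le> ?B a b" by simp
qed

section \<open>Curves with a multiple point\<close>

lemma absolutely_integrable_continuous_bilinear:
  fixes q :: "real \<Rightarrow> 'a::euclidean_space" and g :: "real \<Rightarrow> 'b::euclidean_space"
    and bop :: "'a \<Rightarrow> 'b \<Rightarrow> 'c::euclidean_space"
  assumes "bounded_bilinear bop" "continuous_on {a..b} q" "g absolutely_integrable_on {a..b}"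
  shows "(\<lambda>x. bop (q x) (g x)) absolutely_integrable_on {a..b}"
proof (rule absolutely_integrable_bounded_measurable_product[where h=bop and f=q and g=g, OF _ _ _ _ assms(3)])
  show "bilinear bop" using assms(1) by (simp add: bilinear_conv_bounded_bilinear)
  show "q \<in> borel_measurable (lebesgue_on {a..b})"
    using assms(2) by (rule continuous_imp_measurable_on_sets_lebesgue) simp
  show "bounded (q ` {a..b})"
    using assms(2) by (intro compact_imp_bounded compact_continuous_image) simp_all
qed simp

section \<open>The unit tangent and its density\<close>

lemma has_derivative_normalize:
  fixes z :: "'a::real_inner"
  assumes "z \<noteq> 0"
  shows "((\<lambda>z. (1 / norm z) *\<^sub>R z) has_derivative (\<lambda>v. (1 / norm z) *\<^sub>R v - (1 / norm z ^ 3) *\<^sub>R ((z \<bullet> v) *\<^sub>R z))) (at z)"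
proof -
  have n: "(norm has_derivative (\<lambda>v. v \<bullet> sgn z)) (at z)" using has_derivative_norm[OF assms] .
  have "((\<lambda>z. inverse (norm z)) has_derivative (\<lambda>v. - (inverse (norm z) * (v \<bullet> sgn z) * inverse (norm z)))) (at z)"
    by (rule Deriv.has_derivative_inverse[OF _ n]) (simp add: assms)
  from has_derivative_scaleR[OF this has_derivative_ident]
  have "((\<lambda>z. (1 / norm z) *\<^sub>R z) has_derivative
      (\<lambda>v. (1 / norm z) *\<^sub>R v + (- (inverse (norm z) * (v \<bullet> sgn z) * inverse (norm z))) *\<^sub>R z)) (at z)"
    by (simp only: inverse_eq_divide)
  moreover have "(- (inverse (norm z) * (v \<bullet> sgn z) * inverse (norm z))) *\<^sub>R z = - ((1 / norm z ^ 3) *\<^sub>R ((z \<bullet> v) *\<^sub>R z))" for v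
  proof -
    have "v \<bullet> sgn z = (z \<bullet> v) / norm z" by (simp add: sgn_div_norm inner_commute divide_inverse mult.commute)
    then have "inverse (norm z) * (v \<bullet> sgn z) * inverse (norm z) = (1 / norm z ^ 3) * (z \<bullet> v)"
      by (simp add: field_simps power3_eq_cube)
    then show ?thesis by (simp only: scaleR_minus_left scaleR_scaleR)
  qed
  ultimately show ?thesis by (simp only: add_uminus_conv_diff)
qed

definition unit_tangent :: "(real \<Rightarrow> 'a::real_inner) \<Rightarrow> real \<Rightarrow> 'a" where
  "unit_tangent G x = (1 / norm (G x)) *\<^sub>R G x"

text \<open>With h in the role of G', this is the derivative of G / norm G: the part of h orthogonal
  to G, divided by the speed. It is taken in the parameter, so the curvature vector has a further
  factor 1 / norm G.\<close>

definition unit_tangent_deriv :: "(real \<Rightarrow> 'a::real_inner) \<Rightarrow> (real \<Rightarrow> 'a) \<Rightarrow> real \<Rightarrow> 'a" where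
  "unit_tangent_deriv G h x = (1 / norm (G x)) *\<^sub>R h x - (1 / norm (G x) ^ 3) *\<^sub>R ((G x \<bullet> h x) *\<^sub>R G x)"

lemma norm_unit_tangent: "G x \<noteq> 0 \<Longrightarrow> norm (unit_tangent G x) = 1"
  by (simp add: unit_tangent_def)

lemma unit_tangent_orthogonal: "unit_tangent G x \<bullet> unit_tangent_deriv G h x = 0"
proof (cases "G x = 0")
  case False
  then have "G x \<bullet> G x = norm (G x) * norm (G x)" by (simp add: norm_eq_sqrt_inner)
  then have "G x \<bullet> unit_tangent_deriv G h x = 0"
    using False by (simp add: unit_tangent_deriv_def inner_diff_right power3_eq_cube)
  then show ?thesis by (simp add: unit_tangent_def)
qed (simp add: unit_tangent_def)

text \<open>Only the tangential part of h is discarded, and projection does not increase the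
  norm.\<close>

lemma norm_unit_tangent_deriv_le: "(norm (unit_tangent_deriv G h x))\<^sup>2 \<le> (1 / (norm (G x))\<^sup>2) * (norm (h x))\<^sup>2"
proof (cases "G x = 0")
  case False
  define n where "n = norm (G x)"
  have n: "n > 0" "G x \<bullet> G x = n * n" using False by (simp_all add: n_def norm_eq_sqrt_inner)
  define u where "u = h x - ((G x \<bullet> h x) / (n * n)) *\<^sub>R G x"
  have w: "unit_tangent_deriv G h x = (1 / n) *\<^sub>R u"
    unfolding unit_tangent_deriv_def u_def n_def[symmetric] by (simp add: scaleR_diff_right power3_eq_cube)
  have "u \<bullet> u = h x \<bullet> h x - (G x \<bullet> h x)\<^sup>2 / (n * n)"
    unfolding u_def using n by (simp add: inner_diff_left inner_diff_right inner_commute power2_eq_square)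
  then have "u \<bullet> u \<le> h x \<bullet> h x" using n by simp
  then have "(norm u)\<^sup>2 \<le> (norm (h x))\<^sup>2" by (simp add: power2_norm_eq_inner)
  then have "(1 / n\<^sup>2) * (norm u)\<^sup>2 \<le> (1 / n\<^sup>2) * (norm (h x))\<^sup>2" by (intro mult_left_mono) simp_all
  then show ?thesis unfolding w n_def[symmetric] by (simp add: power_divide power_mult_distrib)
qed (simp add: unit_tangent_deriv_def)

lemma primitive_unit_tangent:
  fixes G h :: "real \<Rightarrow> 'a::euclidean_space"
  assumes G: "primitive_on G h a b" and G0: "\<And>x. x \<in> {a..b} \<Longrightarrow> G x \<noteq> 0"
  shows "primitive_on (unit_tangent G) (unit_tangent_deriv G h) a b"
proof -
  have cG: "continuous_on {a..b} G" by (rule primitive_on_continuous[OF G])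
  \<comment> \<open>The derivative of z \<mapsto> z / norm z at \<open>G x\<close>, written as a
    bounded operator so that its continuity in x can be stated.\<close>
  define D where "D x = blinfun_scaleR_right (1 / norm (G x)) -
     (1 / norm (G x) ^ 3) *\<^sub>R (blinfun_scaleR_left (G x) o\<^sub>L blinfun_inner_right (G x))" for x
  have Dap: "D x v = (1 / norm (G x)) *\<^sub>R v - (1 / norm (G x) ^ 3) *\<^sub>R ((G x \<bullet> v) *\<^sub>R G x)" for x v
    by (simp add: D_def blinfun.diff_left blinfun.scaleR_left)
  have c1: "continuous_on {a..b} (\<lambda>x. 1 / norm (G x))" and c3: "continuous_on {a..b} (\<lambda>x. 1 / norm (G x) ^ 3)"
    using G0 by (auto intro!: continuous_intros cG)
  have h: "h absolutely_integrable_on {a..b}" by (rule primitive_on_absint[OF G])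
  have "primitive_on (\<lambda>x. (\<lambda>z. (1 / norm z) *\<^sub>R z) (G x)) (\<lambda>x. D x (h x)) a b"
  proof (rule primitive_on_compose[OF G])
    show "((\<lambda>z. (1 / norm z) *\<^sub>R z) has_derivative blinfun_apply (D x)) (at (G x))" if "x \<in> {a..b}" for x
      using has_derivative_normalize[OF G0[OF that]] by (simp add: Dap[abs_def])
    show "continuous_on {a..b} D" unfolding D_def
      by (intro continuous_intros c1 c3 cG bounded_linear.continuous_on[OF bounded_linear_blinfun_scaleR_right]
         bounded_linear.continuous_on[OF bounded_linear_blinfun_scaleR_left]
         bounded_linear.continuous_on[OF bounded_linear_blinfun_inner_right])
    have i: "(\<lambda>x. G x \<bullet> h x) absolutely_integrable_on {a..b}"
      by (rule absolutely_integrable_continuous_bilinear[OF bounded_bilinear_inner cG h])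
    have j: "(\<lambda>x. (G x \<bullet> h x) *\<^sub>R G x) absolutely_integrable_on {a..b}"
      by (rule absolutely_integrable_continuous_bilinear[OF bounded_bilinear.flip[OF bounded_bilinear_scaleR] cG i])
    show "(\<lambda>x. D x (h x)) absolutely_integrable_on {a..b}" unfolding Dap
      by (rule set_integral_diff(1)[OF absolutely_integrable_continuous_scaleR[OF c1 h]
        absolutely_integrable_continuous_scaleR[OF c3 j]])
  qed
  then show ?thesis by (simp add: unit_tangent_def[abs_def] unit_tangent_deriv_def[abs_def] Dap)
qed

section \<open>Classical representatives of the curve, its tangent and its curvature\<close>

lemma primitive_continuous:
  assumes "\<And>a b. primitive_on F f a b" shows "continuous_on UNIV F"
proof -
  have "isCont F x" for x
  proof -
    have "continuous_on {x - 1<..<x + 1} F"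
      using primitive_on_continuous[OF assms, of "x - 1" "x + 1"] by (rule continuous_on_subset) auto
    then show ?thesis by (simp add: continuous_on_eq_continuous_at)
  qed
  then show ?thesis by (simp add: continuous_at_imp_continuous_on)
qed

lemma primitive_on_cong_ae:
  fixes f g :: "real \<Rightarrow> 'a::euclidean_space"
  assumes "primitive_on F f a b" "negligible {x. f x \<noteq> g x}"
  shows "primitive_on F g a b"
  unfolding primitive_on_def
proof (intro conjI allI impI)
  show "g absolutely_integrable_on {a..b}"
    using absolutely_integrable_spike[OF primitive_on_absint[OF assms(1)] assms(2)] by auto
  fix x y assume "a \<le> x" "x \<le> y" "y \<le> b"
  from primitive_on_has_integral[OF assms(1) this]
  show "(g has_integral (F y - F x)) {x..y}" by (rule has_integral_spike[OF assms(2), rotated]) auto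
qed

lemma primitive_has_vector_derivative:
  fixes G :: "real \<Rightarrow> 'a::euclidean_space"
  assumes F: "\<And>a b. primitive_on F G a b" and G: "continuous_on UNIV G"
  shows "(F has_vector_derivative G x) (at x)"
proof -
  have "((\<lambda>y. integral {x - 1..y} G) has_vector_derivative G x) (at x within {x - 1..x + 1})"
    by (intro integral_has_vector_derivative continuous_on_subset[OF G]) auto
  then have d: "((\<lambda>y. F (x - 1) + integral {x - 1..y} G) has_vector_derivative 0 + G x) (at x within {x - 1..x + 1})"
    by (intro has_vector_derivative_add has_vector_derivative_const)
  have "(F has_vector_derivative 0 + G x) (at x within {x - 1..x + 1})"
  proof (rule has_vector_derivative_transform[OF _ _ d])
    fix y assume "y \<in> {x - 1..x + 1}"
    then show "F y = F (x - 1) + integral {x - 1..y} G"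
      using integral_unique[OF primitive_on_has_integral[OF F, of "x - 1" "x - 1" y y]] by simp
  qed simp
  moreover have "at x within {x - 1..x + 1} = at x" by (rule at_within_Icc_at) auto
  ultimately show ?thesis by simp
qed

lemma primitive_ae_unique:
  fixes f g :: "real \<Rightarrow> 'a::euclidean_space"
  assumes "primitive_on F f a b" "primitive_on F g a b"
  shows "negligible {x \<in> {a..b}. f x \<noteq> g x}"
proof -
  have "negligible {x \<in> {a..b}. f x - g x \<noteq> 0}"
  proof (rule negligible_if_integrals_zero)
    fix x y assume xy: "a \<le> x" "x \<le> y" "y \<le> b"
    show "((\<lambda>x. f x - g x) has_integral 0) {x..y}"
      using has_integral_diff[OF primitive_on_has_integral[OF assms(1) xy] primitive_on_has_integral[OF assms(2) xy]] by simp
  qed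
  then show ?thesis by simp
qed

lemma weak_deriv: "f has_weak_deriv g \<Longrightarrow> f has_weak_deriv weak_deriv f"
  unfolding weak_deriv_def by (rule someI[where P="\<lambda>g. f has_weak_deriv g"])

text \<open>Converse of the du Bois-Reymond step. \<open>A\<close> is tied to the primitive only
  almost everywhere, since the arclength derivative of the curve is built from an arbitrarily chosen
  weak derivative.\<close>

lemma primitive_has_weak_deriv:
  fixes F :: "real \<Rightarrow> 'a::euclidean_space"
  assumes A: "circle_L1 A" and f: "circle_L1 f" and F: "periodic1 F" "primitive_on F f 0 1"
    and AF: "negligible {x. A x \<noteq> F x}"
  shows "A has_weak_deriv f"
  unfolding has_weak_deriv_def
proof (intro conjI allI impI)
  fix \<phi> :: "real \<Rightarrow> real" assume \<phi>: "circle_test \<phi>"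
  have c: "continuous_on S (deriv \<phi>)" "continuous_on S \<phi>" for S
    using circle_test_continuous_deriv circle_test_continuous \<phi> by auto
  have "primitive_on (\<lambda>x. \<phi> x *\<^sub>R F x) (\<lambda>x. \<phi> x *\<^sub>R f x + deriv \<phi> x *\<^sub>R F x) 0 1"
    by (intro primitive_on_scaleR has_field_derivative_at_within[OF circle_test_DERIV[OF \<phi>]] c F(2))
  from primitive_on_has_integral[OF this, of 0 1]
  have 0: "((\<lambda>x. \<phi> x *\<^sub>R f x + deriv \<phi> x *\<^sub>R F x) has_integral \<phi> 1 *\<^sub>R F 1 - \<phi> 0 *\<^sub>R F 0) {0..1}" by simp
  have "\<phi> (0 + 1) = \<phi> 0" "F (0 + 1) = F 0" using \<phi> F(1) unfolding circle_test_def periodic1_def by blast+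
  with 0 have 1: "((\<lambda>x. \<phi> x *\<^sub>R f x + deriv \<phi> x *\<^sub>R F x) has_integral 0) {0..1}" by simp
  have fi: "(\<lambda>x. \<phi> x *\<^sub>R f x) integrable_on {0..1}"
    using absolutely_integrable_continuous_scaleR[OF c(2) circle_L1_absint[OF f]] by (simp add: absolutely_integrable_on_def)
  from has_integral_diff[OF 1 integrable_integral[OF fi]]
  have "((\<lambda>x. deriv \<phi> x *\<^sub>R F x) has_integral - integral {0..1} (\<lambda>x. \<phi> x *\<^sub>R f x)) {0..1}" by simp
  then have "((\<lambda>x. deriv \<phi> x *\<^sub>R A x) has_integral - integral {0..1} (\<lambda>x. \<phi> x *\<^sub>R f x)) {0..1}"
    by (rule has_integral_spike[OF AF, rotated]) auto
  then show "(LINT x:{0..1}|lborel. deriv \<phi> x *\<^sub>R A x) = - (LINT x:{0..1}|lborel. \<phi> x *\<^sub>R f x)"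
    unfolding LINT_scaleR_circle_L1[OF c(1) A] LINT_scaleR_circle_L1[OF c(2) f] by (rule integral_unique)
qed (rule A f)+

text \<open>The weak derivative is replaced by its absolutely continuous representative G. Being
  continuous, \<gamma> equals its own representative everywhere, so G is its classical derivative
  and immersion becomes a condition on G.\<close>

lemma H2_curve_primitives:
  fixes \<gamma> :: "real \<Rightarrow> 'a::euclidean_space"
  assumes "closed_H2_curve \<gamma>"
  obtains G h where "circle_L1 h" "circle_L2 h" "periodic1 G" "\<And>a b. primitive_on \<gamma> G a b" "\<And>a b. primitive_on G h a b"
    "\<And>x. (\<gamma> has_vector_derivative G x) (at x)" "\<exists>g. \<gamma> has_weak_deriv g"
proof -
  obtain g h where gh: "\<gamma> has_weak_deriv g" "g has_weak_deriv h" "circle_L2 h" and c\<gamma>: "continuous_on UNIV \<gamma>"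
    using assms by (auto simp: closed_H2_curve_def sobolev22_def)
  obtain G where G: "periodic1 G" "\<And>a b. primitive_on G h a b" "negligible {x. g x \<noteq> G x}"
    using has_weak_deriv_primitive[OF gh(2)] by metis
  obtain \<Gamma> where \<Gamma>: "periodic1 \<Gamma>" "\<And>a b. primitive_on \<Gamma> g a b" "negligible {x. \<gamma> x \<noteq> \<Gamma> x}"
    using has_weak_deriv_primitive[OF gh(1)] by metis
  have eq: "\<gamma> = \<Gamma>" using c\<gamma> primitive_continuous[OF \<Gamma>(2)] \<Gamma>(3) by (rule continuous_eq_if_negligible)
  have p\<gamma>: "primitive_on \<gamma> G a b" for a b
    unfolding eq by (rule primitive_on_cong_ae[OF \<Gamma>(2) G(3)])
  have "(\<gamma> has_vector_derivative G x) (at x)" for x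
    by (rule primitive_has_vector_derivative[OF p\<gamma> primitive_continuous[OF G(2)]])
  moreover have "circle_L1 h" using gh(2) by (simp add: has_weak_deriv_def)
  ultimately show thesis using that gh G p\<gamma> by blast
qed

lemma borel_measurable_unit_tangent_deriv:
  fixes G h :: "real \<Rightarrow> 'a::euclidean_space"
  assumes "continuous_on UNIV G" "h \<in> borel_measurable borel"
  shows "unit_tangent_deriv G h \<in> borel_measurable borel"
proof -
  have [measurable]: "G \<in> borel_measurable borel" using assms(1) by (rule borel_measurable_continuous_onI)
  note [measurable] = assms(2)
  show ?thesis unfolding unit_tangent_deriv_def[abs_def] by measurable
qed

text \<open>\<open>curvature\<close> involves two arbitrary choices of a weak derivative. Densities
  of the same primitive agree almost everywhere, so the choices can be compared with G and with the
  derivative of the unit tangent.\<close>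

lemma curvature_ae:
  fixes \<gamma> :: "real \<Rightarrow> 'a::euclidean_space"
  assumes \<gamma>: "\<gamma> has_weak_deriv g" and h: "circle_L1 h" and G: "periodic1 G"
    and p\<gamma>: "\<And>a b. primitive_on \<gamma> G a b" and pG: "\<And>a b. primitive_on G h a b"
    and der: "\<And>x. (\<gamma> has_vector_derivative G x) (at x)" and G0: "\<And>x. G x \<noteq> 0"
  shows "negligible {x \<in> {0..1}. curvature \<gamma> x \<noteq> (1 / norm (G x)) *\<^sub>R unit_tangent_deriv G h x}"
    and "curvature \<gamma> \<in> borel_measurable borel"
proof -
  have cG: "continuous_on S G" for S by (rule continuous_on_subset[OF primitive_continuous[OF pG]]) simp
  have c\<gamma>: "continuous_on UNIV \<gamma>" by (rule primitive_continuous[OF p\<gamma>])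
  have speed: "speed \<gamma> x = norm (G x)" for x using vector_derivative_at[OF der] by (simp add: speed_def)
  have c1: "continuous_on S (\<lambda>x. 1 / norm (G x))" for S by (intro continuous_intros cG ballI) (simp add: G0)
  define g1 where "g1 = weak_deriv \<gamma>"
  have g1: "\<gamma> has_weak_deriv g1" unfolding g1_def by (rule weak_deriv[OF \<gamma>])
  have g1L: "circle_L1 g1" using g1 by (simp add: has_weak_deriv_def)
  obtain \<Gamma> where \<Gamma>: "\<And>a b. primitive_on \<Gamma> g1 a b" "negligible {x. \<gamma> x \<noteq> \<Gamma> x}"
    using has_weak_deriv_primitive[OF g1] by metis
  have "\<gamma> = \<Gamma>" using c\<gamma> primitive_continuous[OF \<Gamma>(1)] \<Gamma>(2) by (rule continuous_eq_if_negligible)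
  then have "primitive_on \<gamma> g1 0 1" using \<Gamma>(1) by simp
  then have "negligible {x \<in> {0..1}. g1 x \<noteq> G x}" using p\<gamma> by (rule primitive_ae_unique)
  moreover have "g1 (x + 1) \<noteq> G (x + 1) \<longleftrightarrow> g1 x \<noteq> G x" for x
    using g1L G by (simp add: circle_L1_def periodic1_def)
  ultimately have g1G: "negligible {x. g1 x \<noteq> G x}" by (intro negligible_periodic[of "\<lambda>x. g1 x \<noteq> G x"])
  define A where "A = arc_deriv \<gamma> \<gamma>"
  have Aeq: "A x = (1 / norm (G x)) *\<^sub>R g1 x" for x by (simp add: A_def arc_deriv_def speed g1_def)
  then have A_fun: "A = (\<lambda>x. (1 / norm (G x)) *\<^sub>R g1 x)" by (rule ext)
  have AT: "negligible {x. A x \<noteq> unit_tangent G x}"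
    by (rule negligible_subset[OF g1G]) (auto simp: Aeq unit_tangent_def)
  have bG: "(\<lambda>x. 1 / norm (G x)) \<in> borel_measurable borel" using c1 by (rule borel_measurable_continuous_onI)
  have bg1: "g1 \<in> borel_measurable borel" and bh: "h \<in> borel_measurable borel"
    using g1L h by (simp_all add: circle_L1_def)
  have AL: "circle_L1 A"
  proof -
    have "A \<in> borel_measurable borel" unfolding A_fun by (rule borel_measurable_scaleR[OF bG bg1])
    moreover have "A absolutely_integrable_on {0..1}" unfolding A_fun
      by (rule absolutely_integrable_continuous_scaleR[OF c1 circle_L1_absint[OF g1L]])
    moreover have "periodic1 A" using g1L G by (simp add: periodic1_def Aeq circle_L1_def)
    ultimately show ?thesis unfolding circle_L1_def using set_integrable_lborel_iff[of A 0 1] by simp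
  qed
  let ?T = "unit_tangent G" and ?w = "unit_tangent_deriv G h"
  have pT: "primitive_on ?T ?w a b" for a b by (rule primitive_unit_tangent[OF pG G0])
  have wL: "circle_L1 ?w"
  proof -
    have "?w \<in> borel_measurable borel" by (rule borel_measurable_unit_tangent_deriv[OF cG bh])
    moreover have "?w absolutely_integrable_on {0..1}" by (rule primitive_on_absint[OF pT])
    moreover have "periodic1 ?w" using G h by (simp add: periodic1_def unit_tangent_deriv_def circle_L1_def)
    ultimately show ?thesis unfolding circle_L1_def using set_integrable_lborel_iff[of ?w 0 1] by simp
  qed
  have "periodic1 ?T" using G by (simp add: periodic1_def unit_tangent_def)
  \<comment> \<open>A weak derivative of \<open>A\<close> must be exhibited before the one picked by
    \<open>weak_deriv\<close> is known to be one.\<close>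
  from primitive_has_weak_deriv[OF AL wL this pT AT] have Aw: "A has_weak_deriv ?w" .
  define w1 where "w1 = weak_deriv A"
  have w1: "A has_weak_deriv w1" unfolding w1_def by (rule weak_deriv[OF Aw])
  obtain U where U: "\<And>a b. primitive_on U w1 a b" "negligible {x. A x \<noteq> U x}"
    using has_weak_deriv_primitive[OF w1] by metis
  have "negligible {x. ?T x \<noteq> U x}"
    by (rule negligible_subset[OF negligible_Un[OF AT U(2)]]) auto
  with primitive_continuous[OF pT] primitive_continuous[OF U(1)] have "?T = U" by (rule continuous_eq_if_negligible)
  then have "primitive_on ?T w1 0 1" using U(1) by simp
  then have w1w: "negligible {x \<in> {0..1}. w1 x \<noteq> ?w x}" using pT by (rule primitive_ae_unique)
  have curv: "curvature \<gamma> x = (1 / norm (G x)) *\<^sub>R w1 x" for x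
    by (simp add: curvature_def arc_deriv_def[of \<gamma> "arc_deriv \<gamma> \<gamma>"] speed w1_def A_def)
  then have curv_fun: "curvature \<gamma> = (\<lambda>x. (1 / norm (G x)) *\<^sub>R w1 x)" by (rule ext)
  show "negligible {x \<in> {0..1}. curvature \<gamma> x \<noteq> (1 / norm (G x)) *\<^sub>R ?w x}"
    by (rule negligible_subset[OF w1w]) (auto simp: curv)
  have "w1 \<in> borel_measurable borel" using w1 by (simp add: has_weak_deriv_def circle_L1_def)
  then show "curvature \<gamma> \<in> borel_measurable borel" unfolding curv_fun by (rule borel_measurable_scaleR[OF bG])
qed

text \<open>Square integrability of the second weak derivative enters here: the density is at most
  norm h ^ 2 / norm G ^ 3, and G is continuous without zeros.\<close>

lemma bending_density_absint:
  fixes G h :: "real \<Rightarrow> 'a::euclidean_space"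
  assumes cG: "continuous_on UNIV G" and G0: "\<And>x. G x \<noteq> 0" and h: "circle_L2 h"
  shows "(\<lambda>x. (norm (unit_tangent_deriv G h x))\<^sup>2 / norm (G x)) absolutely_integrable_on {0..1}" (is "?E absolutely_integrable_on _")
    and "(\<lambda>x. (norm (unit_tangent_deriv G h x))\<^sup>2 / norm (G x)) \<in> borel_measurable borel"
proof -
  have bh: "h \<in> borel_measurable borel" using h by (simp add: circle_L2_def)
  have [measurable]: "G \<in> borel_measurable borel" using cG by (rule borel_measurable_continuous_onI)
  have [measurable]: "unit_tangent_deriv G h \<in> borel_measurable borel"
    by (rule borel_measurable_unit_tangent_deriv[OF cG bh])
  show bE: "?E \<in> borel_measurable borel" by measurable
  have "(\<lambda>x. (norm (h x))\<^sup>2) \<in> borel_measurable lborel" using bh by simp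
  then have "(\<lambda>x. (norm (h x))\<^sup>2) absolutely_integrable_on {0..1}"
    using h set_integrable_lborel_iff[of "\<lambda>x. (norm (h x))\<^sup>2" 0 1] by (simp add: circle_L2_def)
  moreover have "continuous_on {0..1} (\<lambda>x. 1 / norm (G x) ^ 3)"
    using G0 by (auto intro!: continuous_intros continuous_on_subset[OF cG])
  ultimately have "(\<lambda>x. (1 / norm (G x) ^ 3) *\<^sub>R (norm (h x))\<^sup>2) absolutely_integrable_on {0..1}"
    by (intro absolutely_integrable_continuous_scaleR)
  then have i: "(\<lambda>x. (1 / norm (G x) ^ 3) *\<^sub>R (norm (h x))\<^sup>2) integrable_on {0..1}"
    by (simp add: absolutely_integrable_on_def)
  show "?E absolutely_integrable_on {0..1}"
  proof (rule measurable_bounded_by_integrable_imp_absolutely_integrable[OF _ _ i])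
    have "?E \<in> borel_measurable lebesgue" using bE by (simp add: measurable_completion)
    then show "?E \<in> borel_measurable (lebesgue_on {0..1})" by (rule measurable_restrict_space1)
    fix x
    have "?E x \<le> (1 / (norm (G x))\<^sup>2 * (norm (h x))\<^sup>2) / norm (G x)"
      using norm_unit_tangent_deriv_le by (intro divide_right_mono) simp_all
    also have "\<dots> = (1 / norm (G x) ^ 3) *\<^sub>R (norm (h x))\<^sup>2" by (simp add: power2_eq_square power3_eq_cube)
    finally show "norm (?E x) \<le> (1 / norm (G x) ^ 3) *\<^sub>R (norm (h x))\<^sup>2" by simp
  qed simp
qed

section \<open>Summation over the loops\<close>

text \<open>Cauchy-Schwarz in linearised form: 1/L \<ge> 2 c - c^2 L, for c > 0 the tangent to 1/L
  at L = 1/c. The right side adds up over loops, which suits the induction, and c is fixed only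
  later from the total length. \<open>t 0 \<le> t n\<close> is carried along for joining the
  integrals.\<close>

lemma loops_bending_bound:
  fixes \<gamma> :: "real \<Rightarrow> 'a::euclidean_space" and t :: "nat \<Rightarrow> real"
  assumes p\<gamma>: "\<And>a b. primitive_on \<gamma> G a b" and pG: "\<And>a b. primitive_on G h a b" and G0: "\<And>x. G x \<noteq> 0"
    and E: "\<And>a b. (\<lambda>x. (norm (unit_tangent_deriv G h x))\<^sup>2 / norm (G x)) integrable_on {a..b}"
    and \<omega>: "varpi_star \<ge> 0" and t: "\<And>i. i < k \<Longrightarrow> t i < t (Suc i)" "\<And>i. i \<le> k \<Longrightarrow> \<gamma> (t i) = p"
  shows "n \<le> k \<Longrightarrow> t 0 \<le> t n \<and> varpi_star * (2 * c * real n - c\<^sup>2 * integral {t 0..t n} (\<lambda>x. norm (G x)))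
    \<le> integral {t 0..t n} (\<lambda>x. (norm (unit_tangent_deriv G h x))\<^sup>2 / norm (G x))"
proof (induction n)
  case (Suc n)
  let ?v = "\<lambda>x. norm (G x)" and ?E = "\<lambda>x. (norm (unit_tangent_deriv G h x))\<^sup>2 / norm (G x)"
  have cG: "continuous_on S G" for S by (rule continuous_on_subset[OF primitive_continuous[OF pG]]) simp
  have cv: "continuous_on S ?v" for S by (intro continuous_intros cG)
  have lt: "t n < t (Suc n)" using t(1) Suc.prems by simp
  have "(G has_integral 0) {t n..t (Suc n)}"
    using primitive_on_has_integral[OF p\<gamma>, of "t n" "t n" "t (Suc n)" "t (Suc n)"] lt t(2)[of n] t(2)[of "Suc n"] Suc.prems by simp
  then have cl: "((\<lambda>x. ?v x *\<^sub>R unit_tangent G x) has_integral 0) {t n..t (Suc n)}"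
    using G0 by (simp add: unit_tangent_def)
  let ?L = "integral {t n..t (Suc n)} ?v"
  note lb = loop_bending_bound[OF lt primitive_unit_tangent[OF pG G0] norm_unit_tangent[OF G0] unit_tangent_orthogonal cv _ E cl]
  have L: "?L > 0" using lb(1) G0 by simp
  have B: "varpi_star / ?L \<le> integral {t n..t (Suc n)} ?E" using lb(2) G0 by simp
  have "0 \<le> (1 - c * ?L)\<^sup>2 / ?L" using L by simp
  also have "\<dots> = 1 / ?L - (2 * c - c\<^sup>2 * ?L)" using L by (simp add: field_simps power2_eq_square)
  finally have "varpi_star * (2 * c - c\<^sup>2 * ?L) \<le> varpi_star * (1 / ?L)" using \<omega> by (intro mult_left_mono) simp_all
  with B have step: "varpi_star * (2 * c - c\<^sup>2 * ?L) \<le> integral {t n..t (Suc n)} ?E" by simp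
  have IH: "t 0 \<le> t n" "varpi_star * (2 * c * real n - c\<^sup>2 * integral {t 0..t n} ?v) \<le> integral {t 0..t n} ?E"
    using Suc by simp_all
  have "integral {t 0..t n} ?v + ?L = integral {t 0..t (Suc n)} ?v"
    using IH(1) lt by (intro Henstock_Kurzweil_Integration.integral_combine integrable_continuous_real cv) auto
  moreover have "integral {t 0..t n} ?E + integral {t n..t (Suc n)} ?E = integral {t 0..t (Suc n)} ?E"
    using IH(1) lt by (intro Henstock_Kurzweil_Integration.integral_combine E) auto
  moreover have "varpi_star * (2 * c * real n - c\<^sup>2 * integral {t 0..t n} ?v) + varpi_star * (2 * c - c\<^sup>2 * ?L)
    = varpi_star * (2 * c * real (Suc n) - c\<^sup>2 * (integral {t 0..t n} ?v + ?L))" by (simp add: algebra_simps)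
  ultimately show ?case using IH step lt by simp
qed simp

text \<open>The smallest preimage is repeated one period later, so that k points bound k arcs
  filling exactly one period; the last arc crosses the base point.\<close>

lemma multiple_point_sequence:
  assumes "has_point_of_multiplicity \<gamma> p k" "k \<ge> 1" "periodic1 \<gamma>"
  obtains t :: "nat \<Rightarrow> real" where "\<And>i. i < k \<Longrightarrow> t i < t (Suc i)" "\<And>i. i \<le> k \<Longrightarrow> \<gamma> (t i) = p" "t k = t 0 + 1"
proof -
  obtain S where S: "S \<subseteq> {x \<in> {0..<1}. \<gamma> x = p}" "finite S" "card S = k"
    using assms(1) by (auto simp: has_point_of_multiplicity_def)
  define xs where "xs = sorted_list_of_set S"
  have xs: "length xs = k" "set xs = S" "sorted_wrt (<) xs" using S by (simp_all add: xs_def)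
  define t where "t i = (if i < k then xs ! i else xs ! 0 + 1)" for i
  have mem: "xs ! i \<in> S" if "i < k" for i using that xs by auto
  show thesis
  proof
    show "t k = t 0 + 1" using assms(2) by (simp add: t_def)
    show "t i < t (Suc i)" if "i < k" for i
    proof (cases "Suc i < k")
      case True then show ?thesis using xs by (simp add: t_def sorted_wrt_nth_less)
    next
      case False
      have "xs ! i < 1" "0 \<le> xs ! 0" using mem[of i] mem[of 0] that S(1) by auto
      then show ?thesis using False that by (simp add: t_def)
    qed
    show "\<gamma> (t i) = p" if "i \<le> k" for i
    proof -
      have "\<gamma> (xs ! j) = p" if "j < k" for j using mem[OF that] S(1) by auto
      then show ?thesis using assms(2,3) by (simp add: t_def periodic1_def)
    qed
  qed
qed

theorem theorem1p1:
  fixes \<gamma> :: "real \<Rightarrow> real ^ 'n" and p :: "real ^ 'n" and k :: nat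
  assumes "CARD('n) \<ge> 2"
    and "k \<ge> 2"
    and "closed_H2_curve \<gamma>"
    and "immersed \<gamma>"
    and "has_point_of_multiplicity \<gamma> p k"
  shows "normalized_bending_energy \<gamma> \<ge> varpi_star * (real k)\<^sup>2"
proof -
  obtain G h where h: "circle_L1 h" "circle_L2 h" and G: "periodic1 G" and p\<gamma>: "\<And>a b. primitive_on \<gamma> G a b"
    and pG: "\<And>a b. primitive_on G h a b" and der: "\<And>x. (\<gamma> has_vector_derivative G x) (at x)"
    and wd: "\<exists>g. \<gamma> has_weak_deriv g"
    by (rule H2_curve_primitives[OF assms(3)]) blast
  have G0: "G x \<noteq> 0" for x using assms(4) vector_derivative_at[OF der] by (auto simp: immersed_def)
  have cG: "continuous_on S G" for S by (rule continuous_on_subset[OF primitive_continuous[OF pG]]) simp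
  have cv: "continuous_on S (\<lambda>x. norm (G x))" for S by (intro continuous_intros cG)
  have speed: "speed \<gamma> x = norm (G x)" for x using vector_derivative_at[OF der] by (simp add: speed_def)
  let ?v = "\<lambda>x. norm (G x)" and ?E = "\<lambda>x. (norm (unit_tangent_deriv G h x))\<^sup>2 / norm (G x)"
  note Eabs = bending_density_absint[OF cG G0 h(2)]
  have Eper: "periodic1 ?E" using G h by (simp add: periodic1_def unit_tangent_deriv_def circle_L1_def)
  have E: "?E integrable_on {a..b}" for a b
    using absolutely_integrable_periodic[OF Eper Eabs(1)] by (simp add: absolutely_integrable_on_def)
  have vper: "periodic1 ?v" using G by (simp add: periodic1_def)
  have length: "curve_length \<gamma> = integral {0..1} ?v"
    unfolding curve_length_def speed using integral_unique[OF LINT_continuous_has_integral[OF cv]] by simp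
  \<comment> \<open>The chosen curvature agrees with the explicit one off a null set; its
    measurability is needed to identify the Lebesgue integral with the gauge integral.\<close>
  have energy: "bending_energy \<gamma> = integral {0..1} ?E"
  proof -
    obtain g where "\<gamma> has_weak_deriv g" using wd by blast
    note curv = curvature_ae[OF this h(1) G p\<gamma> pG der G0]
    let ?B = "\<lambda>x. (norm (curvature \<gamma> x))\<^sup>2 * speed \<gamma> x"
    have spike: "?B x = ?E x" if "x \<in> {0..1} - {x \<in> {0..1}. curvature \<gamma> x \<noteq> (1 / norm (G x)) *\<^sub>R unit_tangent_deriv G h x}" for x
      using that G0[of x] by (simp add: speed power_divide power2_eq_square)
    have "?B absolutely_integrable_on {0..1}" by (rule absolutely_integrable_spike[OF Eabs(1) curv(1) spike])
    moreover have "?B \<in> borel_measurable lborel"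
      using curv(2) borel_measurable_continuous_onI[OF cv] unfolding speed by simp
    ultimately have "set_integrable lborel {0..1} ?B" using set_integrable_lborel_iff[of ?B 0 1] by simp
    then have "bending_energy \<gamma> = integral {0..1} ?B"
      unfolding bending_energy_def by (rule set_borel_integral_eq_integral)
    also have "\<dots> = integral {0..1} ?E" by (rule integral_spike[OF curv(1) spike[symmetric]])
    finally show ?thesis .
  qed
  have pos: "curve_length \<gamma> \<ge> 0" "bending_energy \<gamma> \<ge> 0"
    unfolding length energy by (intro Henstock_Kurzweil_Integration.integral_nonneg E integrable_continuous_real cv; simp)+
  show ?thesis
  \<comment> \<open>The sum over the loops multiplies an inequality by the constant, which needs its
    sign; for a negative constant the claim follows from the energy being non-negative.\<close>
  proof (cases "varpi_star \<ge> 0")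
    case False
    then have "varpi_star * (real k)\<^sup>2 \<le> 0" by (simp add: mult_nonpos_nonneg)
    also have "0 \<le> normalized_bending_energy \<gamma>" unfolding normalized_bending_energy_def using pos by simp
    finally show ?thesis .
  next
    case True
    have "periodic1 \<gamma>" using wd by (auto simp: has_weak_deriv_def circle_L1_def)
    moreover have "k \<ge> 1" using assms(2) by simp
    ultimately obtain t where t: "\<And>i. i < k \<Longrightarrow> t i < t (Suc i)" "\<And>i. i \<le> k \<Longrightarrow> \<gamma> (t i) = p" "t k = t 0 + 1"
      using multiple_point_sequence[OF assms(5)] by blast
    let ?L = "curve_length \<gamma>"
    have "integral {0..1} (\<lambda>x::real. 0::real) < ?L"
      unfolding length using G0 by (intro integral_less_real cv) auto
    then have L: "?L > 0" by simp
    \<comment> \<open>The reciprocal of the mean loop length. It maximises 2 c k - c^2 L, and the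
      maximum is k^2 / L.\<close>
    define c where "c = real k / ?L"
    \<comment> \<open>The loops start at \<open>t 0\<close> rather than at 0; periodicity moves the
      window of integration.\<close>
    have per: "integral {t 0..t k} ?v = ?L" "integral {t 0..t k} ?E = bending_energy \<gamma>"
      unfolding t(3) length energy
      by (intro integral_periodic_period vper Eper Eabs(1) absolutely_integrable_continuous_real cv)+
    have "varpi_star * (2 * c * real k - c\<^sup>2 * ?L) \<le> bending_energy \<gamma>"
      using loops_bending_bound[where \<gamma>=\<gamma> and G=G and h=h and t=t and p=p and n=k and k=k and c=c, OF p\<gamma> pG G0 E True t(1,2) order_refl] unfolding per by blast
    then have "?L * (varpi_star * (2 * c * real k - c\<^sup>2 * ?L)) \<le> ?L * bending_energy \<gamma>"
      using L by (intro mult_left_mono) simp_all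
    moreover have "?L * (varpi_star * (2 * c * real k - c\<^sup>2 * ?L)) = varpi_star * (real k)\<^sup>2"
      using L by (simp add: c_def field_simps power2_eq_square)
    ultimately show ?thesis by (simp add: normalized_bending_energy_def)
  qed
qed

end
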